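(* Let $p,q>1$ with $\frac1p+\frac1q=1$ and let $\tau,\sigma>0$ be fixed with $$\tau\big(\sigma^{p-1}\|K\|^p+\mu_2^{p-1}L\big)<\mu_1\mu_2^{p-1}.$$ Under the standing assumptions in the context, let $(u^k,v^k)_{k\ge0}\subset X\times Y^*$ be generated by the generalized Condat–Vũ algorithm $$u^{k+1}\in\arg\min_{u\in X}\Big\{G(u^k)+\langle G'(u^k),u-u^k\rangle+R(u)+\langle Ku,v^k\rangle+\tfrac1\tau D_\varphi(u,u^k)\Big\},$$ $$v^{k+1}\in\arg\min_{v\in Y^*}\Big\{H_{f^\delta}^*(v)-\langle v,K(2u^{k+1}-u^k)\rangle+\tfrac1\sigma D_\psi(v,v^k)\Big\},$$ with $u^0\in\operatorname{dom}G'\cap\operatorname{dom}\partial R$ and $v^0\in\operatorname{dom}\partial H_{f^\delta}^*$. Assume that there exist $C>0$, $\zeta^\delta\in\partial H_{f^\delta}^*(v^\dagger)$ and $\zeta\in\partial H_f^*(v^\dagger)$ such that $$\forall k\in\mathbb N:\quad\langle\zeta^\delta-\zeta,\,v^\dagger-v^k\rangle\le C\delta\|v^\dagger-v^k\|_{Y^*}.$$ Let $\overline u^n=\frac1n\sum_{k=1}^nu^k$ and $\overline v^n=\frac1n\sum_{k=1}^nv^k$. Then there exist $\nu>0$ and $\bar C>0$ such that for every $n\in\mathbb N$, $n\ge1$, $$D_{R+G}(\overline u^n,u^\dagger)+D_{H_{f^\delta}^*}(\overline v^n,v^\dagger)\le\frac1nD_B(w^\dagger,w^0)+\frac{\bar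 C^pq^{p/q}}{\nu^{p/q}}\delta^pn^{p-1}+C\Big(\frac{pq}{\nu}D_B(w^\dagger,w^0)\Big)^{1/q}\delta,$$ where $w^\dagger=(u^\dagger,v^\dagger)$, $w^0=(u^0,v^0)$ and $$B(u,v)=\frac1\tau\varphi(u)+\frac1\sigma\psi(v)-\langle v,Ku\rangle-G(u).$$
   Context: Standing assumptions. - $X,Y$ are reflexive (real) Banach spaces; $K:X\to Y$ is linear, bounded and ill-posed (a qualitative description; no further quantitative property is meant). - $f\in Y$ is the exact data, $f^\delta\in Y$ noisy data with $\|f-f^\delta\|\le\delta$. - $H_f=i_{\{f\}}$ is the indicator function of $\{f\}$; $H_{f^\delta}:Y\to\mathbb R\cup\{+\infty\}$ is proper, convex, lower semicontinuous. Their Fenchel conjugates $H_f^*,H_{f^\delta}^*$ are functions on $Y^*$, with subdifferentials in $Y^{**}$. - $R:X\to\mathbb R\cup\{+\infty\}$ is proper, convex, lower semicontinuous. - $G:X\to\mathbb R\cup\{+\infty\}$ is proper, convex, Fréchet differentiable with derivative $G'$, and $L$-smooth: $D_G(u_1,u_2)\le\frac Lp\|u_1-u_2\|_X^p$ for all $u_1,u_2\in\operatorname{int}\operatorname{dom}G$. - There exists $\bar u\in\operatorname{dom}(H_f\circ K)\cap\operatorname{dom}R\cap\operatorname{dom}G$ such that $R+G$ is continuous at $\bar u$. - $u^\dagger\in X$ is a solution of $\inf_{u\in X}\{R(u)+G(u)\}$ subject to $Ku=f$, with $R(u^\dagger),G(u^\dagger)$ finite. - Source condition: $v^\dagger\in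 Y^*$ satisfies $-K^*v^\dagger\in\partial(R+G)(u^\dagger)$. - $\varphi:X\to\mathbb R\cup\{+\infty\}$ is proper, lower semicontinuous, essentially smooth, essentially strictly convex (in the sense of Bauschke–Borwein–Combettes), $\operatorname{dom}\partial R\subset\operatorname{int}(\operatorname{dom}\varphi)$, at least one of $R,\varphi$ is supercoercive, and $\varphi$ is $\mu_1$-strongly convex ($\mu_1>0$): $D_\varphi(u_1,u_2)\ge\frac{\mu_1}p\|u_1-u_2\|_X^p$ for all $u_1,u_2\in\operatorname{dom}\varphi$. - $\psi:Y^*\to\mathbb R\cup\{+\infty\}$ is proper, lower semicontinuous, essentially smooth, essentially strictly convex, $\operatorname{dom}\partial H_{f^\delta}^*\subset\operatorname{int}(\operatorname{dom}\psi)$, at least one of $H_{f^\delta}^*,\psi$ is supercoercive, and $\psi$ is $\mu_2$-strongly convex ($\mu_2>0$): $D_\psi(v_1,v_2)\ge\frac{\mu_2}q\|v_1-v_2\|_{Y^*}^q$ for all $v_1,v_2\in\operatorname{dom}\psi$. Here $h$ is supercoercive if $h(u)/\|u\|\to+\infty$ as $\|u\|\to+\infty$. The Bregman distance of a convex $g$ with respect to $\xi\in\partial g(y)$ is $D_g(x,y)=g(x)-g(y)-\langle\xi,x-y\rangle$; for differentiable $g$, $\xi$ is the derivative at $y$ (this applies to $\varphi,\psi,G,B$). In the conclusion, $D_{R+G}(\cdot,u^\dagger)$ is taken with respect to $-K^*v^\dagger$, and $D_{H_{f^\delta}^*}(\cdot,v^\dagger)$ with respect to $\zeta^\delta$. 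*)

theory Defs
  imports "HOL-Analysis.Analysis"
begin

text \<open>
  The dual of a real normed space \<open>'a\<close> is the type \<open>'a \<Rightarrow>\<^sub>L real\<close> with the operator norm; the
  adjoint of \<open>K\<close> applied to \<open>v\<close> is \<open>v o\<^sub>L K\<close>. Functions with values in the reals extended by
  \<open>+\<infinity>\<close> have type \<open>'a \<Rightarrow> ereal\<close>; that \<open>-\<infinity>\<close> is not attained is part of properness.
\<close>

definition reflexive_space :: "'a::real_normed_vector itself \<Rightarrow> bool" where
  "reflexive_space _ \<longleftrightarrow>
     (\<forall>F :: ('a \<Rightarrow>\<^sub>L real) \<Rightarrow>\<^sub>L real. \<exists>x::'a. \<forall>v. blinfun_apply F v = blinfun_apply v x)"

definition edom :: "('a \<Rightarrow> ereal) \<Rightarrow> 'a set" where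
  "edom f = {x. f x < \<infinity>}"

definition eproper :: "('a \<Rightarrow> ereal) \<Rightarrow> bool" where
  "eproper f \<longleftrightarrow> (\<forall>x. f x \<noteq> -\<infinity>) \<and> edom f \<noteq> {}"

definition econvex :: "('a::real_vector \<Rightarrow> ereal) \<Rightarrow> bool" where
  "econvex f \<longleftrightarrow> (\<forall>x y t. 0 < t \<longrightarrow> t < 1 \<longrightarrow>
     f ((1 - t) *\<^sub>R x + t *\<^sub>R y) \<le> ereal (1 - t) * f x + ereal t * f y)"

definition strictly_econvex_on :: "'a::real_vector set \<Rightarrow> ('a \<Rightarrow> ereal) \<Rightarrow> bool" where
  "strictly_econvex_on C f \<longleftrightarrow> (\<forall>x\<in>C. \<forall>y\<in>C. \<forall>t. x \<noteq> y \<longrightarrow> 0 < t \<longrightarrow> t < 1 \<longrightarrow>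
     f ((1 - t) *\<^sub>R x + t *\<^sub>R y) < ereal (1 - t) * f x + ereal t * f y)"

definition elsc :: "('a::topological_space \<Rightarrow> ereal) \<Rightarrow> bool" where
  "elsc f \<longleftrightarrow> (\<forall>c. closed {x. f x \<le> c})"

definition supercoercive :: "('a::real_normed_vector \<Rightarrow> ereal) \<Rightarrow> bool" where
  "supercoercive f \<longleftrightarrow> ((\<lambda>x. f x / ereal (norm x)) \<longlongrightarrow> \<infinity>) at_infinity"

definition indicator_fun :: "'a set \<Rightarrow> 'a \<Rightarrow> ereal" where
  "indicator_fun S x = (if x \<in> S then 0 else \<infinity>)"

definition conj_fun :: "('a::real_normed_vector \<Rightarrow> ereal) \<Rightarrow> ('a \<Rightarrow>\<^sub>L real) \<Rightarrow> ereal" where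
  "conj_fun f v = (SUP x. ereal (blinfun_apply v x) - f x)"

definition subdiff :: "('a::real_normed_vector \<Rightarrow> ereal) \<Rightarrow> 'a \<Rightarrow> ('a \<Rightarrow>\<^sub>L real) set" where
  "subdiff f x =
     {\<xi>. \<bar>f x\<bar> \<noteq> \<infinity> \<and> (\<forall>y. f x + ereal (blinfun_apply \<xi> (y - x)) \<le> f y)}"

definition dom_subdiff :: "('a::real_normed_vector \<Rightarrow> ereal) \<Rightarrow> 'a set" where
  "dom_subdiff f = {x. subdiff f x \<noteq> {}}"

definition inv_subdiff :: "('a::real_normed_vector \<Rightarrow> ereal) \<Rightarrow> ('a \<Rightarrow>\<^sub>L real) \<Rightarrow> 'a set" where
  "inv_subdiff f \<xi> = {x. \<xi> \<in> subdiff f x}"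

definition locally_bounded_on_dom ::
    "('a::topological_space \<Rightarrow> 'b::real_normed_vector set) \<Rightarrow> bool" where
  "locally_bounded_on_dom T \<longleftrightarrow>
     (\<forall>x. T x \<noteq> {} \<longrightarrow> (\<exists>U. open U \<and> x \<in> U \<and> bounded (\<Union>y\<in>U. T y)))"

text \<open>
  The notions of Bauschke, Borwein and Combettes (2001), who state them for proper, convex, lower
  semicontinuous functions only; these properties are to be assumed separately.
\<close>

definition essentially_smooth :: "('a::real_normed_vector \<Rightarrow> ereal) \<Rightarrow> bool" where
  "essentially_smooth f \<longleftrightarrow>
     locally_bounded_on_dom (subdiff f) \<and> (\<forall>x\<in>dom_subdiff f. \<exists>!\<xi>. \<xi> \<in> subdiff f x)"

definition essentially_strictly_convex :: "('a::real_normed_vector \<Rightarrow> ereal) \<Rightarrow> bool" where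
  "essentially_strictly_convex f \<longleftrightarrow>
     locally_bounded_on_dom (inv_subdiff f) \<and>
     (\<forall>C. convex C \<longrightarrow> C \<subseteq> dom_subdiff f \<longrightarrow> strictly_econvex_on C f)"

text \<open>
  The difference quotient is an \<open>ereal\<close>; its finite limit forces \<open>f\<close> to be real-valued near \<open>x\<close>
  on every line through \<open>x\<close>.
\<close>

definition has_gateaux ::
    "('a::real_normed_vector \<Rightarrow> ereal) \<Rightarrow> ('a \<Rightarrow>\<^sub>L real) \<Rightarrow> 'a \<Rightarrow> bool" where
  "has_gateaux f \<xi> x \<longleftrightarrow> \<bar>f x\<bar> \<noteq> \<infinity> \<and>
     (\<forall>h. ((\<lambda>t. (f (x + t *\<^sub>R h) - f x) / ereal t) \<longlongrightarrow> ereal (blinfun_apply \<xi> h)) (at 0))"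

lemma has_gateaux_unique: "has_gateaux f \<xi> x \<Longrightarrow> has_gateaux f \<eta> x \<Longrightarrow> \<xi> = \<eta>"
proof (rule blinfun_eqI)
  fix h
  assume "has_gateaux f \<xi> x" "has_gateaux f \<eta> x"
  then have "((\<lambda>t. (f (x + t *\<^sub>R h) - f x) / ereal t) \<longlongrightarrow> ereal (blinfun_apply \<xi> h)) (at 0)"
    and "((\<lambda>t. (f (x + t *\<^sub>R h) - f x) / ereal t) \<longlongrightarrow> ereal (blinfun_apply \<eta> h)) (at 0)"
    by (simp_all add: has_gateaux_def)
  from tendsto_unique[OF trivial_limit_at this]
  show "blinfun_apply \<xi> h = blinfun_apply \<eta> h" by simp
qed

text \<open>
  The first conjunct says that \<open>f\<close> is real-valued near \<open>x\<close>, so that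
  \<open>real_of_ereal\<close> does not hide infinite values.
\<close>

definition has_frechet ::
    "('a::real_normed_vector \<Rightarrow> ereal) \<Rightarrow> ('a \<Rightarrow>\<^sub>L real) \<Rightarrow> 'a \<Rightarrow> bool" where
  "has_frechet f \<xi> x \<longleftrightarrow> x \<in> interior {y. \<bar>f y\<bar> \<noteq> \<infinity>} \<and>
     ((\<lambda>y. real_of_ereal (f y)) has_derivative blinfun_apply \<xi>) (at x)"

definition bregman_wrt ::
    "('a::real_normed_vector \<Rightarrow> ereal) \<Rightarrow> ('a \<Rightarrow>\<^sub>L real) \<Rightarrow> 'a \<Rightarrow> 'a \<Rightarrow> ereal" where
  "bregman_wrt f \<xi> x y = f x - f y - ereal (blinfun_apply \<xi> (x - y))"

text \<open>
  Bregman distance with respect to the derivative at the second argument. Where there is no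
  derivative the value is \<open>+\<infinity>\<close>, the convention of Bauschke, Borwein and Combettes; so a lower
  bound on \<open>bregman f\<close> is no restriction there.
\<close>

definition bregman :: "('a::real_normed_vector \<Rightarrow> ereal) \<Rightarrow> 'a \<Rightarrow> 'a \<Rightarrow> ereal" where
  "bregman f x y =
     (if \<exists>\<xi>. has_gateaux f \<xi> y then bregman_wrt f (THE \<xi>. has_gateaux f \<xi> y) x y else \<infinity>)"

definition smooth_fun :: "real \<Rightarrow> real \<Rightarrow> ('a::real_normed_vector \<Rightarrow> ereal) \<Rightarrow> bool" where
  "smooth_fun p L g \<longleftrightarrow> (\<forall>x\<in>interior (edom g). \<forall>y\<in>interior (edom g).
     bregman g x y \<le> ereal (L / p * norm (x - y) powr p))"

definition strongly_convex_fun :: "real \<Rightarrow> real \<Rightarrow> ('a::real_normed_vector \<Rightarrow> ereal) \<Rightarrow> bool" where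
  "strongly_convex_fun p \<mu> g \<longleftrightarrow> (\<forall>x\<in>edom g. \<forall>y\<in>edom g.
     ereal (\<mu> / p * norm (x - y) powr p) \<le> bregman g x y)"

text \<open>Meaningful only for \<open>0 \<le> x\<close> and \<open>0 < a\<close>.\<close>

definition epowr :: "ereal \<Rightarrow> real \<Rightarrow> ereal" where
  "epowr x a = (if x = \<infinity> then \<infinity> else ereal (real_of_ereal x powr a))"

text \<open>
  \<open>G'\<close> is the derivative of \<open>G\<close> and \<open>Hs\<close> the conjugate of the data term. The first conjunct,
  \<open>u k \<in> dom G'\<close>, is what makes the expression minimized in the first step meaningful.
\<close>

definition condat_vu ::
    "('a::real_normed_vector \<Rightarrow> ereal) \<Rightarrow> ('a \<Rightarrow> ereal) \<Rightarrow> ('a \<Rightarrow> 'a \<Rightarrow>\<^sub>L real) \<Rightarrow>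
     (('b::real_normed_vector \<Rightarrow>\<^sub>L real) \<Rightarrow> ereal) \<Rightarrow> ('a \<Rightarrow>\<^sub>L 'b) \<Rightarrow>
     ('a \<Rightarrow> ereal) \<Rightarrow> (('b \<Rightarrow>\<^sub>L real) \<Rightarrow> ereal) \<Rightarrow> real \<Rightarrow> real \<Rightarrow>
     (nat \<Rightarrow> 'a) \<Rightarrow> (nat \<Rightarrow> 'b \<Rightarrow>\<^sub>L real) \<Rightarrow> bool" where
  "condat_vu R G G' Hs K \<phi> \<psi> \<tau> \<sigma> u v \<longleftrightarrow> (\<forall>k.
     has_frechet G (G' (u k)) (u k) \<and>
     is_arg_min
       (\<lambda>x. G (u k) + ereal (blinfun_apply (G' (u k)) (x - u k)) + R x
            + ereal (blinfun_apply (v k) (blinfun_apply K x))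
            + ereal (1 / \<tau>) * bregman \<phi> x (u k))
       (\<lambda>_. True) (u (Suc k)) \<and>
     is_arg_min
       (\<lambda>y. Hs y - ereal (blinfun_apply y (blinfun_apply K (2 *\<^sub>R u (Suc k) - u k)))
            + ereal (1 / \<sigma>) * bregman \<psi> y (v k))
       (\<lambda>_. True) (v (Suc k)))"

definition B_fun ::
    "('a::real_normed_vector \<Rightarrow> ereal) \<Rightarrow> ('a \<Rightarrow>\<^sub>L 'b::real_normed_vector) \<Rightarrow>
     ('a \<Rightarrow> ereal) \<Rightarrow> (('b \<Rightarrow>\<^sub>L real) \<Rightarrow> ereal) \<Rightarrow> real \<Rightarrow> real \<Rightarrow>
     'a \<times> ('b \<Rightarrow>\<^sub>L real) \<Rightarrow> ereal" where
  "B_fun G K \<phi> \<psi> \<tau> \<sigma> = (\<lambda>(u, v).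
     ereal (1 / \<tau>) * \<phi> u + ereal (1 / \<sigma>) * \<psi> v
     - ereal (blinfun_apply v (blinfun_apply K u)) - G u)"

definition avg :: "(nat \<Rightarrow> 'a::real_vector) \<Rightarrow> nat \<Rightarrow> 'a" where
  "avg x n = (1 / real n) *\<^sub>R (\<Sum>k=1..n. x k)"

end

theory Submission
  imports Defs
begin

text \<open>
  Both steps of the iteration are minimizations of a convex function plus a Bregman distance. By the
  sum rule for subdifferentials, their solutions lie in \<open>dom \<partial>R\<close> and \<open>dom \<partial>H\<^sup>*\<close>, hence in the interior
  of the domains of the kernels, where these are Gateaux differentiable; so the iteration is well
  defined and satisfies its optimality conditions. Adding the two conditions at \<open>(u\<^sup>\<dagger>, v\<^sup>\<dagger>)\<close> gives, with
  \<open>\<Delta> k = D\<^sub>B(w\<^sup>\<dagger>, w\<^sup>k)\<close> and \<open>d k\<close> the left-hand side of the claim at \<open>(u\<^sup>k, v\<^sup>k)\<close>,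
  \<open>d (k + 1) \<le> \<Delta> k - \<Delta> (k + 1) + C \<delta> \<parallel>v\<^sup>\<dagger> - v\<^sup>k\<^sup>+\<^sup>1\<parallel>\<close>. The step size condition is what Young's inequality
  needs for \<open>c \<parallel>v\<^sup>\<dagger> - v\<^sup>k\<parallel>\<^sup>q \<le> \<Delta> k\<close> with some \<open>c > 0\<close>. Summing bounds first \<open>max\<^sub>k \<parallel>v\<^sup>\<dagger> - v\<^sup>k\<parallel>\<close> and then
  \<open>\<Sum> d k\<close>; Jensen's inequality passes to the averages, with \<open>\<nu> = q c\<close> and \<open>Cbar = C\<close>.
\<close>

section \<open>The Hahn-Banach theorem\<close>

definition sublinear :: "('a::real_vector \<Rightarrow> real) \<Rightarrow> bool" where
  "sublinear q \<longleftrightarrow> (\<forall>x y. q (x + y) \<le> q x + q y) \<and> (\<forall>t>0. \<forall>x. q (t *\<^sub>R x) = t * q x)"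

lemma sublinear_add: "sublinear q \<Longrightarrow> q (x + y) \<le> q x + q y"
  by (simp add: sublinear_def)

lemma sublinear_scale: "sublinear q \<Longrightarrow> t > 0 \<Longrightarrow> q (t *\<^sub>R x) = t * q x"
  by (simp add: sublinear_def)

lemma sublinear_0: "sublinear q \<Longrightarrow> q 0 = 0"
  using sublinear_scale[of q 2 0] by simp

lemma sublinear_neg: "sublinear q \<Longrightarrow> - q (- x) \<le> q x"
  using sublinear_add[of q x "- x"] sublinear_0[of q] by simp

text \<open>The inequality for the factor \<open>1 / t\<close> at the vector \<open>t x\<close> is
  the converse one, so an upper bound on the scaled value suffices.\<close>

lemma sublinearI:
  assumes "\<And>x y. q (x + y) \<le> q x + q y" and scale: "\<And>t x. t > 0 \<Longrightarrow> q (t *\<^sub>R x) \<le> t * q x"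
  shows "sublinear q"
proof -
  have "q (t *\<^sub>R x) = t * q x" if "t > 0" for t x
  proof -
    have "q x \<le> (1 / t) * q (t *\<^sub>R x)"
      using scale[of "1 / t" "t *\<^sub>R x"] that by simp
    then show ?thesis
      using scale[OF that, of x] that by (simp add: field_simps)
  qed
  then show ?thesis
    using assms(1) by (simp add: sublinear_def)
qed

text \<open>Zorn's lemma for the pointwise order. The lower bound of a chain is its pointwise
  infimum: it is finite because \<open>a x\<close> is at least \<open>- p (- x)\<close>, and
  subadditive because any two members of a chain are comparable.\<close>

lemma sublinear_minimal_exists:
  assumes p: "sublinear p"
  shows "\<exists>m. sublinear m \<and> (\<forall>x. m x \<le> p x) \<and>
    (\<forall>q. sublinear q \<longrightarrow> (\<forall>x. q x \<le> m x) \<longrightarrow> q = m)"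
proof -
  define S where "S = {q. sublinear q \<and> (\<forall>x. q x \<le> p x)}"
  \<comment> \<open>\<open>P a b\<close> places \<open>b\<close> below \<open>a\<close>, so a
    maximal element for \<open>P\<close> is a pointwise minimal functional.\<close>
  define P where "P = (\<lambda>(a :: 'a \<Rightarrow> real) b. \<forall>x. b x \<le> a x)"
  have po: "partial_order_on S (relation_of P S)"
    by (rule partial_order_on_relation_ofI) (auto simp: P_def fun_eq_iff intro: order_trans antisym)
  have "\<exists>u\<in>S. \<forall>a\<in>C. P a u" if C: "C \<in> Chains (relation_of P S)" for C
  proof (cases "C = {}")
    case True
    then show ?thesis
      using p by (auto simp: S_def)
  next
    case False
    have CS: "C \<subseteq> S" and chain: "\<And>a b. a \<in> C \<Longrightarrow> b \<in> C \<Longrightarrow> P a b \<or> P b a"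
      using C by (auto simp: Chains_def relation_of_def)
    have sub: "sublinear a" "a x \<le> p x" if "a \<in> C" for a x
      using CS that by (auto simp: S_def)
    define i where "i x = (INF a\<in>C. a x)" for x
    have bdd: "bdd_below ((\<lambda>a. a x) ` C)" for x
    proof (rule bdd_belowI2)
      fix a assume "a \<in> C"
      then show "- p (- x) \<le> a x"
        using sublinear_neg[OF sub(1), of a x] sub(2)[of a "- x"] by fastforce
    qed
    have i_le: "i x \<le> a x" if "a \<in> C" for a x
      unfolding i_def using bdd that by (rule cINF_lower)
    have le_i: "c \<le> i x" if "\<And>a. a \<in> C \<Longrightarrow> c \<le> a x" for c x
      unfolding i_def using False that by (rule cINF_greatest)
    have "sublinear i"
    proof (rule sublinearI)
      fix x y
      \<comment> \<open>Subadditivity of the smaller of \<open>a\<close> and \<open>b\<close>, which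
        bounds the other one at both \<open>x\<close> and \<open>y\<close>.\<close>
      have "i (x + y) \<le> a x + b y" if "a \<in> C" "b \<in> C" for a b
        using chain[OF that] i_le[OF that(1), of "x + y"] i_le[OF that(2), of "x + y"]
          sublinear_add[OF sub(1)[OF that(1)], of x y] sublinear_add[OF sub(1)[OF that(2)], of x y]
        unfolding P_def by (smt (verit))
      then have "i (x + y) - b y \<le> i x" if "b \<in> C" for b
        using that by (intro le_i) (simp add: algebra_simps)
      then have "i (x + y) - i x \<le> i y"
        by (intro le_i) (simp add: algebra_simps)
      then show "i (x + y) \<le> i x + i y" by simp
    next
      fix t :: real and x assume t: "t > 0"
      have "i (t *\<^sub>R x) / t \<le> i x"
      proof (rule le_i)
        fix a assume a: "a \<in> C"
        show "i (t *\<^sub>R x) / t \<le> a x"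
          using i_le[OF a, of "t *\<^sub>R x"] sublinear_scale[OF sub(1)[OF a] t, of x] t
          by (simp add: field_simps)
      qed
      then show "i (t *\<^sub>R x) \<le> t * i x"
        using t by (simp add: field_simps)
    qed
    moreover have "i x \<le> p x" for x
      using False i_le sub(2) by (meson all_not_in_conv order_trans)
    ultimately have "i \<in> S" by (simp add: S_def)
    then show ?thesis
      using i_le by (auto simp: P_def)
  qed
  from predicate_Zorn[OF po this] obtain m where "m \<in> S" and m: "\<forall>a\<in>S. P m a \<longrightarrow> a = m"
    by blast
  then show ?thesis
    by (intro exI[of _ m]) (auto simp: S_def P_def intro: order_trans)
qed

text \<open>
  A minimal sublinear functional is linear: minimality forces it to agree with the smaller
  sublinear functional \<open>x \<mapsto> inf\<^bsub>t \<ge> 0\<^esub> m (x + t y) - t m y\<close>, which is at most \<open>- m y\<close> at \<open>- y\<close>.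
\<close>

theorem hahn_banach_sublinear:
  fixes p :: "'a::real_vector \<Rightarrow> real"
  assumes "sublinear p"
  shows "\<exists>l. linear l \<and> (\<forall>x. l x \<le> p x)"
proof -
  obtain m where m: "sublinear m" and mp: "\<forall>x. m x \<le> p x"
    and min: "\<And>q. sublinear q \<Longrightarrow> \<forall>x. q x \<le> m x \<Longrightarrow> q = m"
    using sublinear_minimal_exists[OF assms] by blast
  have scale0: "m (t *\<^sub>R x) = t * m x" if "t \<ge> 0" for t x
    using sublinear_scale[OF m, of t x] sublinear_0[OF m] that by (cases "t = 0") auto
  have neg: "m (- y) \<le> - m y" for y
  proof -
    define d where "d t x = m (x + t *\<^sub>R y) - t * m y" for t x
    define i where "i x = (INF t\<in>{0..}. d t x)" for x
    have "- m (- x) \<le> d t x" if "t \<ge> 0" for t x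
      using sublinear_add[OF m, of "x + t *\<^sub>R y" "- x"] scale0[OF that, of y] by (simp add: d_def)
    then have bdd: "bdd_below ((\<lambda>t. d t x) ` {0..})" for x
      by (intro bdd_belowI2[of _ "- m (- x)"]) auto
    have i_le: "i x \<le> d t x" if "t \<ge> 0" for t x
      unfolding i_def using bdd that by (intro cINF_lower) auto
    have le_i: "c \<le> i x" if "\<And>t. t \<ge> 0 \<Longrightarrow> c \<le> d t x" for c x
      unfolding i_def using that by (intro cINF_greatest) auto
    have "sublinear i"
    proof (rule sublinearI)
      fix x z
      \<comment> \<open>The infimum for \<open>x + z\<close> is tested with the parameter
        \<open>s + t\<close>.\<close>
      have "i (x + z) \<le> d s x + d t z" if "s \<ge> 0" "t \<ge> 0" for s t
        using i_le[of "s + t" "x + z"] that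
          sublinear_add[OF m, of "x + s *\<^sub>R y" "z + t *\<^sub>R y"]
        by (simp add: d_def algebra_simps)
      then have "i (x + z) - d t z \<le> i x" if "t \<ge> 0" for t
        using that by (intro le_i) (simp add: algebra_simps)
      then have "i (x + z) - i x \<le> i z"
        by (intro le_i) (simp add: algebra_simps)
      then show "i (x + z) \<le> i x + i z" by simp
    next
      fix s :: real and x assume s: "s > 0"
      have "i (s *\<^sub>R x) / s \<le> i x"
      proof (rule le_i)
        fix t :: real assume t: "t \<ge> 0"
        have "i (s *\<^sub>R x) \<le> d (s * t) (s *\<^sub>R x)"
          using s t by (intro i_le) simp
        also have "\<dots> = s * d t x"
          using sublinear_scale[OF m s, of "x + t *\<^sub>R y"] by (simp add: d_def algebra_simps)
        finally show "i (s *\<^sub>R x) / s \<le> d t x"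
          using s by (simp add: field_simps)
      qed
      then show "i (s *\<^sub>R x) \<le> s * i x"
        using s by (simp add: field_simps)
    qed
    moreover have "\<forall>x. i x \<le> m x"
      using i_le[of 0] by (simp add: d_def)
    ultimately have "i = m" by (rule min)
    then show ?thesis
      using i_le[of 1 "- y"] sublinear_0[OF m] by (simp add: d_def)
  qed
  have neg_eq: "m (- y) = - m y" for y
    using neg[of y] sublinear_neg[OF m, of y] by simp
  have "linear m"
  proof (rule linearI)
    fix x y
    show "m (x + y) = m x + m y"
      using sublinear_add[OF m, of x y] sublinear_add[OF m, of "- x" "- y"] neg_eq[of "x + y"]
        neg_eq[of x] neg_eq[of y] by simp
  next
    fix t x
    show "m (t *\<^sub>R x) = t *\<^sub>R m x"
      using scale0[of t x] scale0[of "- t" x] neg_eq[of "t *\<^sub>R x"] by (cases "t \<ge> 0") auto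
  qed
  then show ?thesis
    using mp by blast
qed

text \<open>A hyperplane supporting \<open>A\<close> from below at the origin. The infimum of
  \<open>r / t\<close> over all \<open>t > 0\<close> with \<open>(t z, r)\<close> in
  \<open>A\<close> is sublinear in \<open>z\<close>, so Hahn-Banach puts a linear functional below
  it. The ball at height \<open>M\<close> makes the infimum finite and the functional
  bounded.\<close>

lemma convex_set_supporting_functional:
  fixes A :: "('a::real_normed_vector \<times> real) set"
  assumes A: "convex A" and above0: "\<And>r. (0, r) \<in> A \<Longrightarrow> 0 \<le> r"
    and e: "e > 0" and M: "\<And>z. norm z < e \<Longrightarrow> (z, M) \<in> A"
  shows "\<exists>\<xi>. \<forall>(z, r)\<in>A. blinfun_apply \<xi> z \<le> r"
proof -
  have comb: "((s * a) *\<^sub>R x + (t * a) *\<^sub>R y, (s * r + t * r') * a) \<in> A"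
    if "(x, r) \<in> A" "(y, r') \<in> A" "s > 0" "t > 0" "a = 1 / (s + t)" for x y r r' s t a
  proof -
    have "s * a + t * a = 1"
      using that by (simp add: add_divide_distrib[symmetric])
    then have "(s * a) *\<^sub>R (x, r) + (t * a) *\<^sub>R (y, r') \<in> A"
      using that by (intro convexD[OF A]) auto
    then show ?thesis by (simp add: algebra_simps)
  qed
  define T where "T z = {r / t |r t. t > 0 \<and> (t *\<^sub>R z, r) \<in> A}" for z
  define p where "p z = Inf (T z)" for z
  \<comment> \<open>\<open>z\<close> is rescaled to norm \<open>e / 2\<close>, strictly inside the
    ball; the origin needs its own element, \<open>M_in\<close>.\<close>
  have small: "M * (2 * norm z / e) \<in> T z" if "z \<noteq> 0" for z
  proof -
    have "((e / (2 * norm z)) *\<^sub>R z, M) \<in> A"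
      using that e by (intro M) simp
    moreover have "M * (2 * norm z / e) = M / (e / (2 * norm z))"
      using that e by simp
    ultimately show ?thesis
      unfolding T_def using that e by (intro CollectI exI conjI) auto
  qed
  have M_in: "M / 1 \<in> T 0"
    unfolding T_def using M[of 0] e by (intro CollectI exI[of _ M] exI[of _ "1::real"] conjI refl) auto
  have ne: "T z \<noteq> {}" for z
    using small[of z] M_in by (cases "z = 0") auto
  have bdd: "bdd_below (T z)" for z
  proof -
    \<comment> \<open>The vector \<open>- s z\<close> then has norm below \<open>e\<close>. A convex
      combination of \<open>(t z, r)\<close> and \<open>(- s z, M)\<close> lies above the origin,
      where \<open>above0\<close> applies; this bounds \<open>r / t\<close> from below. The added 1
      covers \<open>z = 0\<close>.\<close>
    define s where "s = e / (2 * (norm z + 1))"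
    have np: "norm z + 1 > 0" by (smt (verit) norm_ge_zero)
    have s: "s > 0" using e np by (simp add: s_def)
    have sM: "((- s) *\<^sub>R z, M) \<in> A"
    proof (rule M)
      have "norm ((- s) *\<^sub>R z) = e * (norm z / (2 * (norm z + 1)))"
        using e np by (simp add: s_def)
      also have "\<dots> < e * 1"
        using np e by (intro mult_strict_left_mono) (auto simp: field_simps)
      finally show "norm ((- s) *\<^sub>R z) < e" by simp
    qed
    show ?thesis
    proof (rule bdd_belowI[of _ "- M / s"])
      fix c assume "c \<in> T z"
      then obtain r t where c: "c = r / t" and t: "t > 0" and r: "(t *\<^sub>R z, r) \<in> A"
        by (auto simp: T_def)
      have "0 \<le> (s * r + t * M) * (1 / (s + t))"
        using comb[OF r sM s t refl] by (intro above0) (simp add: algebra_simps)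
      then have "0 \<le> s * r + t * M"
        using s t by (simp add: zero_le_divide_iff)
      then show "- M / s \<le> c"
        using s t by (simp add: c field_simps)
    qed
  qed
  have p_le: "p z \<le> r / t" if "t > 0" "(t *\<^sub>R z, r) \<in> A" for z r t
    unfolding p_def using bdd that by (intro cInf_lower) (auto simp: T_def)
  have le_p: "c \<le> p z" if "\<And>r t. t > 0 \<Longrightarrow> (t *\<^sub>R z, r) \<in> A \<Longrightarrow> c \<le> r / t" for c z
    unfolding p_def using ne that by (intro cInf_greatest) (auto simp: T_def)
  have "sublinear p"
  proof (rule sublinearI)
    fix x y
    \<comment> \<open>The weights are crossed, \<open>t\<close> for the point over
      \<open>s x\<close> and \<open>s\<close> for the one over \<open>t y\<close>, so that both
      vectors get the same factor.\<close>
    have "p (x + y) \<le> r / s + r' / t"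
      if "s > 0" "(s *\<^sub>R x, r) \<in> A" "t > 0" "(t *\<^sub>R y, r') \<in> A" for s r t r'
    proof -
      define a where "a = 1 / (t + s)"
      have a: "a > 0" using that by (simp add: a_def)
      have "((s * t * a) *\<^sub>R (x + y), (t * r + s * r') * a) \<in> A"
        using comb[OF that(2,4,3,1) a_def] by (simp add: algebra_simps)
      then have "p (x + y) \<le> ((t * r + s * r') * a) / (s * t * a)"
        using that a by (intro p_le) auto
      also have "\<dots> = r / s + r' / t"
        using that a by (simp add: field_simps)
      finally show ?thesis .
    qed
    then have "p (x + y) - r' / t \<le> p x" if "t > 0" "(t *\<^sub>R y, r') \<in> A" for t r'
      using that by (intro le_p) (simp add: algebra_simps)
    then have "p (x + y) - p x \<le> p y"
      by (intro le_p) (simp add: algebra_simps)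
    then show "p (x + y) \<le> p x + p y" by simp
  next
    fix s :: real and x assume s: "s > 0"
    have "p (s *\<^sub>R x) / s \<le> p x"
    proof (rule le_p)
      fix r t :: real assume t: "t > 0" and r: "(t *\<^sub>R x, r) \<in> A"
      have "p (s *\<^sub>R x) \<le> r / (t / s)"
        using s t r by (intro p_le) auto
      then show "p (s *\<^sub>R x) / s \<le> r / t"
        using s t by (simp add: field_simps)
    qed
    then show "p (s *\<^sub>R x) \<le> s * p x"
      using s by (simp add: field_simps)
  qed
  then obtain l where l: "linear l" and lp: "\<And>x. l x \<le> p x"
    using hahn_banach_sublinear by blast
  have l_le: "l z \<le> norm z * (2 * M / e)" for z
  proof (cases "z = 0")
    case True
    then show ?thesis using linear_0[OF l] by simp
  next
    case False
    then have "p z \<le> M * (2 * norm z / e)"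
      unfolding p_def using bdd small by (intro cInf_lower) auto
    then show ?thesis
      using lp[of z] by (simp add: mult_ac)
  qed
  have "norm (l z) \<le> norm z * (2 * M / e)" for z
    using l_le[of z] l_le[of "- z"] linear_neg[OF l, of z] by simp
  then have bl: "bounded_linear l"
    using l by (intro bounded_linear_intro[of _ "2 * M / e"]) (auto simp: linear_add linear_scale)
  have "l z \<le> r" if "(z, r) \<in> A" for z r
    using lp[of z] p_le[of 1 z r] that by simp
  then show ?thesis
    using bl by (intro exI[of _ "Blinfun l"]) (auto simp: bounded_linear_Blinfun_apply)
qed

section \<open>Subgradients of convex functions\<close>

text \<open>Real upper bounds instead of values, and weights that may vanish: infinite values and
  end points are dealt with here once and for all.\<close>

lemma econvexD_real:
  assumes f: "econvex f" and "f x \<le> ereal a" "f y \<le> ereal b" "0 \<le> s" "0 \<le> t" "s + t = 1"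
  shows "f (s *\<^sub>R x + t *\<^sub>R y) \<le> ereal (s * a + t * b)"
proof (cases "t = 0 \<or> s = 0")
  case True
  then show ?thesis using assms by auto
next
  case False
  then have s: "s = 1 - t" "0 < t" "t < 1" using assms by auto
  have "f (s *\<^sub>R x + t *\<^sub>R y) \<le> ereal s * f x + ereal t * f y"
    using f s unfolding econvex_def by blast
  also have "\<dots> \<le> ereal s * ereal a + ereal t * ereal b"
    using assms by (intro add_mono ereal_mult_left_mono) auto
  finally show ?thesis by simp
qed

lemma subdiffD:
  assumes "\<xi> \<in> subdiff f x" "f x = ereal a" "f y \<le> ereal b"
  shows "a + blinfun_apply \<xi> (y - x) \<le> b"
proof -
  have "ereal a + ereal (blinfun_apply \<xi> (y - x)) \<le> f y"
    using assms by (auto simp: subdiff_def)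
  then have "ereal (a + blinfun_apply \<xi> (y - x)) \<le> ereal b"
    using assms(3) unfolding plus_ereal.simps by (rule order_trans)
  then show ?thesis by simp
qed

lemma subdiffI:
  assumes "f x = ereal a" "\<And>y. f y \<noteq> - \<infinity>"
    and "\<And>y b. f y = ereal b \<Longrightarrow> a + blinfun_apply \<xi> (y - x) \<le> b"
  shows "\<xi> \<in> subdiff f x"
proof -
  have "f x + ereal (blinfun_apply \<xi> (y - x)) \<le> f y" for y
    using assms by (cases "f y") auto
  then show ?thesis
    using assms(1) by (simp add: subdiff_def)
qed

lemma dom_subdiff_finite: "x \<in> dom_subdiff f \<Longrightarrow> \<bar>f x\<bar> \<noteq> \<infinity>"
  by (auto simp: dom_subdiff_def subdiff_def)

text \<open>Fermat's rule with the Moreau-Rockafellar sum rule; \<open>g\<close> is bounded above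
  near a point where \<open>F\<close> is finite. The set \<open>A\<close> lies over the value
  function of the problem in which the argument of \<open>g\<close> is shifted by \<open>z\<close>.
  Minimality makes it nonnegative over 0, and a supporting functional of \<open>A\<close> is the
  multiplier.\<close>

lemma fermat_rule_convex_sum:
  fixes F g :: "'a::real_normed_vector \<Rightarrow> ereal" and l :: "'a \<Rightarrow>\<^sub>L real"
  assumes F: "econvex F" "\<And>x. F x \<noteq> - \<infinity>" and g: "econvex g" "\<And>x. g x \<noteq> - \<infinity>"
    and w: "w > 0" and x0: "F x0 = ereal a" "g x0 = ereal b"
    and min: "\<And>x c d. F x \<le> ereal c \<Longrightarrow> g x \<le> ereal d \<Longrightarrow>
      a + w * b + blinfun_apply l x0 \<le> c + w * d + blinfun_apply l x"
    and y0: "F y0 < \<infinity>" and e: "e > 0" and M: "\<And>z. norm (z - y0) < e \<Longrightarrow> g z \<le> ereal M"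
  shows "\<exists>\<xi>\<in>subdiff g x0. - (l + w *\<^sub>R \<xi>) \<in> subdiff F x0"
proof -
  define m where "m = a + w * b + blinfun_apply l x0"
  define A where "A = {(z, r). \<exists>x c d. F x \<le> ereal c \<and> g (x + z) \<le> ereal d \<and>
    c + w * d + blinfun_apply l x - m \<le> r}"
  have AI: "(z, r) \<in> A" if "F x \<le> ereal c" "g (x + z) \<le> ereal d"
      "c + w * d + blinfun_apply l x - m \<le> r" for x c z d r
    unfolding A_def using that by blast
  have "convex A"
  proof (rule convexI)
    fix w1 w2 :: "'a \<times> real" and s t :: real
    assume "w1 \<in> A" "w2 \<in> A" and st: "0 \<le> s" "0 \<le> t" "s + t = 1"
    then obtain z r x c d z' r' x' c' d' where ww: "w1 = (z, r)" "w2 = (z', r')"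
      and 1: "F x \<le> ereal c" "g (x + z) \<le> ereal d" "c + w * d + blinfun_apply l x - m \<le> r"
      and 2: "F x' \<le> ereal c'" "g (x' + z') \<le> ereal d'" "c' + w * d' + blinfun_apply l x' - m \<le> r'"
      unfolding A_def by blast
    have "F (s *\<^sub>R x + t *\<^sub>R x') \<le> ereal (s * c + t * c')"
      using econvexD_real[OF F(1) 1(1) 2(1) st] .
    moreover have "g (s *\<^sub>R x + t *\<^sub>R x' + (s *\<^sub>R z + t *\<^sub>R z')) \<le> ereal (s * d + t * d')"
      using econvexD_real[OF g(1) 1(2) 2(2) st] by (simp add: algebra_simps)
    moreover have "s * c + t * c' + w * (s * d + t * d') + blinfun_apply l (s *\<^sub>R x + t *\<^sub>R x') - m
        \<le> s * r + t * r'"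
    proof -
      have "s * (c + w * d + blinfun_apply l x - m) + t * (c' + w * d' + blinfun_apply l x' - m)
          \<le> s * r + t * r'"
        using 1(3) 2(3) st by (intro add_mono mult_left_mono) auto
      moreover have "s * m + t * m = m"
        using st(3) by (metis distrib_right mult_1)
      ultimately show ?thesis
        by (simp add: algebra_simps blinfun.add_right blinfun.scaleR_right)
    qed
    ultimately show "s *\<^sub>R w1 + t *\<^sub>R w2 \<in> A"
      unfolding ww scaleR_Pair add_Pair by (simp add: AI)
  qed
  moreover have "0 \<le> r" if A: "(0, r) \<in> A" for r
  proof -
    obtain x c d where "F x \<le> ereal c" "g (x + 0) \<le> ereal d"
      "c + w * d + blinfun_apply l x - m \<le> r"
      using A unfolding A_def by auto
    then show ?thesis
      using min[of x c d] by (simp add: m_def)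
  qed
  moreover obtain c0 where c0: "F y0 = ereal c0"
    using y0 F(2)[of y0] by (cases "F y0") auto
  have "(z, c0 + w * M + blinfun_apply l y0 - m) \<in> A" if "norm z < e" for z
    using c0 M[of "y0 + z"] that by (intro AI[of y0 c0 z M]) auto
  ultimately obtain \<eta> where \<eta>: "\<forall>(z, r)\<in>A. blinfun_apply \<eta> z \<le> r"
    using convex_set_supporting_functional[of A e] e by blast
  have \<eta>_le: "blinfun_apply \<eta> z \<le> c + w * d + blinfun_apply l x - m"
    if "F x = ereal c" "g (x + z) = ereal d" for x z c d
  proof -
    have "(z, c + w * d + blinfun_apply l x - m) \<in> A"
      using AI[of x c z d] that by simp
    then show ?thesis using \<eta> by auto
  qed
  \<comment> \<open>Shifts that keep the argument of \<open>g\<close> at \<open>x0\<close> isolate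
    the subgradient inequality of \<open>F\<close>; keeping that of \<open>F\<close> at
    \<open>x0\<close> isolates the one of \<open>g\<close>, with factor \<open>w\<close>.\<close>
  show ?thesis
  proof (intro bexI[of _ "(1 / w) *\<^sub>R \<eta>"])
    show "- (l + w *\<^sub>R (1 / w) *\<^sub>R \<eta>) \<in> subdiff F x0"
    proof (rule subdiffI[of F, OF x0(1) F(2)])
      fix y c assume "F y = ereal c"
      then show "a + blinfun_apply (- (l + w *\<^sub>R (1 / w) *\<^sub>R \<eta>)) (y - x0) \<le> c"
        using \<eta>_le[of y c "x0 - y" b] x0 w
        by (simp add: m_def blinfun.minus_left blinfun.add_left blinfun.diff_left blinfun.diff_right)
    qed
    show "(1 / w) *\<^sub>R \<eta> \<in> subdiff g x0"
    proof (rule subdiffI[of g, OF x0(2) g(2)])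
      fix y d assume "g y = ereal d"
      then have "blinfun_apply \<eta> (y - x0) \<le> w * (d - b)"
        using \<eta>_le[of x0 a "y - x0" d] x0 by (simp add: m_def algebra_simps)
      then show "b + blinfun_apply ((1 / w) *\<^sub>R \<eta>) (y - x0) \<le> d"
        using w by (simp add: blinfun.scaleR_left field_simps)
    qed
  qed
qed

text \<open>The hard half of the formula for the directional derivative as a maximum over
  subgradients: \<open>s\<close> is a lower bound of the difference quotients along
  \<open>h\<close>. The set \<open>A\<close> lies over the infimum over \<open>t \<ge> 0\<close> of
  \<open>g (x0 + z + t h) - a - t s\<close>, which this bound keeps nonnegative at
  \<open>z = 0\<close>.\<close>

lemma subgradient_in_direction:
  fixes g :: "'a::real_normed_vector \<Rightarrow> ereal"
  assumes g: "econvex g" "\<And>x. g x \<noteq> - \<infinity>" and x0: "g x0 = ereal a"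
    and e: "e > 0" and M: "\<And>z. norm (z - x0) < e \<Longrightarrow> g z \<le> ereal M"
    and s: "\<And>t r. t > 0 \<Longrightarrow> g (x0 + t *\<^sub>R h) \<le> ereal r \<Longrightarrow> t * s \<le> r - a"
  shows "\<exists>\<xi>\<in>subdiff g x0. s \<le> blinfun_apply \<xi> h"
proof -
  define A where "A = {(z, r). \<exists>t\<ge>0. g (x0 + z + t *\<^sub>R h) \<le> ereal (a + r + t * s)}"
  have "convex A"
  proof (rule convexI)
    fix w w' :: "'a \<times> real" and \<alpha> \<beta> :: real
    assume "w \<in> A" "w' \<in> A" and ab: "0 \<le> \<alpha>" "0 \<le> \<beta>" "\<alpha> + \<beta> = 1"
    then obtain z r t z' r' t' where w: "w = (z, r)" "w' = (z', r')"
      and 1: "t \<ge> 0" "g (x0 + z + t *\<^sub>R h) \<le> ereal (a + r + t * s)"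
      and 2: "t' \<ge> 0" "g (x0 + z' + t' *\<^sub>R h) \<le> ereal (a + r' + t' * s)"
      by (auto simp: A_def)
    have \<alpha>: "\<alpha> = 1 - \<beta>" using ab by simp
    have "\<alpha> *\<^sub>R (x0 + z + t *\<^sub>R h) + \<beta> *\<^sub>R (x0 + z' + t' *\<^sub>R h)
        = x0 + (\<alpha> *\<^sub>R z + \<beta> *\<^sub>R z') + (\<alpha> * t + \<beta> * t') *\<^sub>R h"
      unfolding \<alpha> by (simp add: algebra_simps)
    moreover have "\<alpha> * (a + r + t * s) + \<beta> * (a + r' + t' * s)
        = a + (\<alpha> * r + \<beta> * r') + (\<alpha> * t + \<beta> * t') * s"
      unfolding \<alpha> by (simp add: algebra_simps)
    ultimately have "g (x0 + (\<alpha> *\<^sub>R z + \<beta> *\<^sub>R z') + (\<alpha> * t + \<beta> * t') *\<^sub>R h)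
        \<le> ereal (a + (\<alpha> * r + \<beta> * r') + (\<alpha> * t + \<beta> * t') * s)"
      using econvexD_real[OF g(1) 1(2) 2(2) ab] by simp
    then show "\<alpha> *\<^sub>R w + \<beta> *\<^sub>R w' \<in> A"
      using ab 1(1) 2(1) by (auto simp: A_def w intro!: exI[of _ "\<alpha> * t + \<beta> * t'"])
  qed
  moreover have "0 \<le> r" if A: "(0, r) \<in> A" for r
  proof -
    obtain t where t: "t \<ge> 0" "g (x0 + 0 + t *\<^sub>R h) \<le> ereal (a + r + t * s)"
      using A unfolding A_def by auto
    show ?thesis
      using s[of t "a + r + t * s"] t x0 by (cases "t = 0") auto
  qed
  moreover have "(z, M - a) \<in> A" if "norm z < e" for z
    using M[of "x0 + z"] that by (auto simp: A_def intro!: exI[of _ 0])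
  ultimately obtain \<xi> where \<xi>: "\<forall>(z, r)\<in>A. blinfun_apply \<xi> z \<le> r"
    using convex_set_supporting_functional[of A e] e by blast
  \<comment> \<open>The choice \<open>t = 1\<close> leads back to \<open>x0\<close>, so the
    supporting functional is at most \<open>- s\<close> at \<open>- h\<close>.\<close>
  have "(- h, - s) \<in> A"
    using x0 by (auto simp: A_def intro!: exI[of _ 1])
  then have "s \<le> blinfun_apply \<xi> h"
    using \<xi> by (auto simp: blinfun.minus_right)
  moreover have "\<xi> \<in> subdiff g x0"
  proof (rule subdiffI[of g, OF x0 g(2)])
    fix y b assume "g y = ereal b"
    then have "(y - x0, b - a) \<in> A"
      by (auto simp: A_def intro!: exI[of _ 0])
    then show "a + blinfun_apply \<xi> (y - x0) \<le> b"
      using \<xi> by auto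
  qed
  ultimately show ?thesis by blast
qed

text \<open>The contrapositive of Baire's theorem that a countable union of closed sets without
  interior has no interior.\<close>

lemma closed_cover_interior_nonempty:
  fixes C :: "nat \<Rightarrow> 'a::{complete_space} set"
  assumes "\<And>n. closed (C n)" "interior (\<Union>n. C n) \<noteq> {}"
  shows "\<exists>n. interior (C n) \<noteq> {}"
proof (rule ccontr)
  assume "\<not> ?thesis"
  then have "Met_TC.mtopology interior_of \<Union> (range C) = {}"
    using assms(1)
    by (intro Met_TC.metric_Baire_category_alt) (auto simp: complete_UNIV)
  then show False using assms(2) by simp
qed

text \<open>The sublevel sets at the natural numbers are closed and cover the domain, so by Baire
  one of them contains a ball, around some \<open>z0\<close>. Shrinking this ball towards a domain
  point \<open>y\<close> beyond \<open>x\<close> moves it to \<open>x\<close>, and convexity carries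
  the bound along.\<close>

lemma bounded_above_near_interior:
  fixes f :: "'a::banach \<Rightarrow> ereal"
  assumes f: "econvex f" "elsc f" and x: "x \<in> interior (edom f)"
  shows "\<exists>e>0. \<exists>M. \<forall>z. norm (z - x) < e \<longrightarrow> f z \<le> ereal M"
proof -
  have "edom f \<subseteq> (\<Union>n. {z. f z \<le> ereal (real n)})"
  proof
    fix z assume "z \<in> edom f"
    then show "z \<in> (\<Union>n. {z. f z \<le> ereal (real n)})"
      using real_arch_simple by (cases "f z") (auto simp: edom_def)
  qed
  then have "interior (\<Union>n. {z. f z \<le> ereal (real n)}) \<noteq> {}"
    using x interior_mono by blast
  then obtain n z0 where "z0 \<in> interior {z. f z \<le> ereal (real n)}"
    using closed_cover_interior_nonempty[of "\<lambda>n. {z. f z \<le> ereal (real n)}"] f(2)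
    by (auto simp: elsc_def)
  then obtain e0 where e0: "e0 > 0" and n: "\<And>z. norm (z - z0) < e0 \<Longrightarrow> f z \<le> ereal (real n)"
    by (auto simp: mem_interior subset_iff dist_norm norm_minus_commute)
  obtain e1 where e1: "e1 > 0" and dom: "\<And>z. norm (z - x) < e1 \<Longrightarrow> f z < \<infinity>"
    using x by (auto simp: mem_interior subset_iff dist_norm norm_minus_commute edom_def)
  \<comment> \<open>Small enough that \<open>y\<close>, on the line from \<open>z0\<close> through
    \<open>x\<close> and past \<open>x\<close>, stays in the domain.\<close>
  define s where "s = e1 / (2 * (norm (x - z0) + 1))"
  have np: "norm (x - z0) + 1 > 0" by (smt (verit) norm_ge_zero)
  have s: "s > 0" using e1 np by (simp add: s_def)
  define y where "y = x + s *\<^sub>R (x - z0)"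
  have "norm (y - x) = e1 * (norm (x - z0) / (2 * (norm (x - z0) + 1)))"
    using e1 np by (simp add: y_def s_def)
  also have "\<dots> < e1 * 1"
    using np e1 by (intro mult_strict_left_mono) (auto simp: field_simps)
  finally have "f y < \<infinity>" by (intro dom) simp
  then obtain b where b: "f y \<le> ereal b" by (cases "f y") auto
  \<comment> \<open>The weight for which \<open>x = (1 - t) y + t z0\<close>.\<close>
  define t where "t = s / (1 + s)"
  have t: "0 < t" "t < 1" "(1 + s) * t = s" "(1 + s) * (1 - t) = 1"
    using s by (auto simp: t_def field_simps)
  have "f z \<le> ereal ((1 - t) * b + t * real n)" if "norm (z - x) < t * e0" for z
  proof -
    have "norm ((1 / t) *\<^sub>R (z - x)) < e0"
      using that t by (simp add: pos_divide_less_eq mult.commute)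
    then have "f (z0 + (1 / t) *\<^sub>R (z - x)) \<le> ereal (real n)"
      by (intro n) simp
    then have "f ((1 - t) *\<^sub>R y + t *\<^sub>R (z0 + (1 / t) *\<^sub>R (z - x))) \<le> ereal ((1 - t) * b + t * real n)"
      using t by (intro econvexD_real[OF f(1) b]) auto
    moreover have "(1 - t) *\<^sub>R y + t *\<^sub>R z0 = x"
    proof -
      have "(1 - t) * s = t" using t by (simp add: algebra_simps)
      then show ?thesis
        unfolding y_def by (simp add: algebra_simps flip: scaleR_add_left)
    qed
    moreover have "(1 - t) *\<^sub>R y + t *\<^sub>R (z0 + (1 / t) *\<^sub>R (z - x)) = (1 - t) *\<^sub>R y + t *\<^sub>R z0 + (z - x)"
      using t by (simp add: scaleR_add_right)
    ultimately show ?thesis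
      by simp
  qed
  then show ?thesis
    using t e0 by (intro exI[of _ "t * e0"]) auto
qed

section \<open>Gateaux derivatives of convex functions\<close>

lemma bregman_eq:
  assumes "has_gateaux f \<xi> y"
  shows "bregman f x y = f x - f y - ereal (blinfun_apply \<xi> (x - y))"
proof -
  have "(THE \<xi>. has_gateaux f \<xi> y) = \<xi>"
    using assms by (intro the_equality) (auto intro: has_gateaux_unique)
  then show ?thesis
    unfolding bregman_def bregman_wrt_def using assms by (simp only: if_P[OF exI[of _ \<xi>]])
qed

text \<open>Trades the extended real limit for a real one, to which the rules for limits and
  derivatives apply.\<close>

lemma has_gateaux_iff_real:
  assumes "\<And>h. eventually (\<lambda>t. \<bar>f (x + t *\<^sub>R h)\<bar> \<noteq> \<infinity>) (at 0)" "\<bar>f x\<bar> \<noteq> \<infinity>"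
  shows "has_gateaux f \<xi> x \<longleftrightarrow>
    (\<forall>h. ((\<lambda>t. (real_of_ereal (f (x + t *\<^sub>R h)) - real_of_ereal (f x)) / t)
      \<longlongrightarrow> blinfun_apply \<xi> h) (at 0))"
proof -
  have "((\<lambda>t. (f (x + t *\<^sub>R h) - f x) / ereal t) \<longlongrightarrow> ereal (blinfun_apply \<xi> h)) (at 0) \<longleftrightarrow>
    ((\<lambda>t. (real_of_ereal (f (x + t *\<^sub>R h)) - real_of_ereal (f x)) / t)
      \<longlongrightarrow> blinfun_apply \<xi> h) (at 0)" for h
  proof -
    have "eventually (\<lambda>t. t \<noteq> (0::real)) (at 0)"
      by (simp add: eventually_at_filter)
    with assms(1)[of h] have "eventually (\<lambda>t. (f (x + t *\<^sub>R h) - f x) / ereal t =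
        ereal ((real_of_ereal (f (x + t *\<^sub>R h)) - real_of_ereal (f x)) / t)) (at 0)"
    proof eventually_elim
      case (elim t)
      then show ?case
        using assms(2) by (cases "f x"; cases "f (x + t *\<^sub>R h)") auto
    qed
    from tendsto_cong[OF this] show ?thesis
      by simp
  qed
  then show ?thesis
    unfolding has_gateaux_def using assms(2) by blast
qed

lemma eventually_finite_along_line:
  fixes f :: "'a::real_normed_vector \<Rightarrow> ereal"
  assumes "x \<in> interior {y. \<bar>f y\<bar> \<noteq> \<infinity>}"
  shows "eventually (\<lambda>t. \<bar>f (x + t *\<^sub>R h)\<bar> \<noteq> \<infinity>) (at (0::real))"
proof -
  define S where "S = {y. \<bar>f y\<bar> \<noteq> \<infinity>}"
  have "((\<lambda>t. x + t *\<^sub>R h) \<longlongrightarrow> x + 0 *\<^sub>R h) (at (0::real))"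
    by (intro tendsto_intros)
  moreover have "x + 0 *\<^sub>R h \<in> interior S"
    using assms by (simp add: S_def)
  ultimately have "eventually (\<lambda>t. x + t *\<^sub>R h \<in> interior S) (at (0::real))"
    using open_interior topological_tendstoD by blast
  then show ?thesis
  proof (rule eventually_mono)
    fix t :: real assume "x + t *\<^sub>R h \<in> interior S"
    then have "x + t *\<^sub>R h \<in> S"
      using interior_subset by blast
    then show "\<bar>f (x + t *\<^sub>R h)\<bar> \<noteq> \<infinity>"
      unfolding S_def by (rule CollectD)
  qed
qed

lemma frechet_imp_gateaux:
  assumes "has_frechet f \<xi> x"
  shows "has_gateaux f \<xi> x"
proof -
  have x: "x \<in> interior {y. \<bar>f y\<bar> \<noteq> \<infinity>}"
    and d: "((\<lambda>y. real_of_ereal (f y)) has_derivative blinfun_apply \<xi>) (at x)"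
    using assms by (auto simp: has_frechet_def)
  have "((\<lambda>t. (real_of_ereal (f (x + t *\<^sub>R h)) - real_of_ereal (f x)) / t)
      \<longlongrightarrow> blinfun_apply \<xi> h) (at 0)" for h
  proof -
    have "((\<lambda>y. real_of_ereal (f y)) has_derivative blinfun_apply \<xi>) (at (x + 0 *\<^sub>R h))"
      using d by simp
    moreover have "((\<lambda>t. x + t *\<^sub>R h) has_derivative (\<lambda>t. t *\<^sub>R h)) (at (0::real))"
      by (auto intro!: derivative_eq_intros)
    ultimately have "((\<lambda>t. real_of_ereal (f (x + t *\<^sub>R h))) has_derivative
        (\<lambda>t. blinfun_apply \<xi> (t *\<^sub>R h))) (at 0)"
      using has_derivative_compose by blast
    then have "((\<lambda>t. real_of_ereal (f (x + t *\<^sub>R h))) has_real_derivative blinfun_apply \<xi> h) (at 0)"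
      by (simp add: has_field_derivative_def blinfun.scaleR_right mult_commute_abs)
    then show ?thesis
      by (simp add: DERIV_def)
  qed
  moreover have "\<bar>f x\<bar> \<noteq> \<infinity>"
    using interior_subset[THEN subsetD, OF x] by (rule CollectD)
  ultimately show ?thesis
    by (intro iffD2[OF has_gateaux_iff_real[OF eventually_finite_along_line[OF x]]] allI)
qed

text \<open>By convexity the difference quotients towards \<open>y\<close> are at most
  \<open>f y - f x\<close> for \<open>t\<close> in (0, 1); the limit from the right inherits
  this.\<close>

lemma gateaux_in_subdiff:
  assumes g: "has_gateaux f \<xi> x" and f: "econvex f" "\<And>y. f y \<noteq> - \<infinity>"
  shows "\<xi> \<in> subdiff f x"
proof -
  obtain a where a: "f x = ereal a"
    using g by (cases "f x") (auto simp: has_gateaux_def)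
  show ?thesis
  proof (rule subdiffI[of f, OF a f(2)])
    fix y b assume b: "f y = ereal b"
    have "((\<lambda>t. (f (x + t *\<^sub>R (y - x)) - f x) / ereal t) \<longlongrightarrow> ereal (blinfun_apply \<xi> (y - x))) (at_right 0)"
      using g filterlim_at_split unfolding has_gateaux_def by blast
    moreover have "eventually (\<lambda>t. (f (x + t *\<^sub>R (y - x)) - f x) / ereal t \<le> ereal (b - a)) (at_right 0)"
      using eventually_at_right_real[of 0 1, simplified]
    proof eventually_elim
      case (elim t)
      have "f ((1 - t) *\<^sub>R x + t *\<^sub>R y) \<le> ereal ((1 - t) * a + t * b)"
        using elim a b by (intro econvexD_real[OF f(1)]) auto
      then have le: "f (x + t *\<^sub>R (y - x)) \<le> ereal (a + t * (b - a))"
        by (simp add: algebra_simps)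
      then obtain c where "f (x + t *\<^sub>R (y - x)) = ereal c"
        using f(2)[of "x + t *\<^sub>R (y - x)"] by (cases "f (x + t *\<^sub>R (y - x))") auto
      then show ?case
        using le a elim by (simp add: field_simps)
    qed
    ultimately have "ereal (blinfun_apply \<xi> (y - x)) \<le> ereal (b - a)"
      by (intro tendsto_upperbound) auto
    then show "a + blinfun_apply \<xi> (y - x) \<le> b" by simp
  qed
qed

text \<open>\<open>f\<close> is bounded above near \<open>x\<close>, hence subdifferentiable there,
  and essential smoothness leaves a single subgradient. It bounds the quotients from below; its
  uniqueness forces them down to it as \<open>t\<close> decreases to 0.\<close>

lemma gateaux_on_interior:
  fixes f :: "'a::banach \<Rightarrow> ereal"
  assumes f: "econvex f" "elsc f" "\<And>y. f y \<noteq> - \<infinity>" and smooth: "essentially_smooth f"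
    and x: "x \<in> interior (edom f)"
  shows "\<exists>\<xi>. has_gateaux f \<xi> x \<and> subdiff f x = {\<xi>}"
proof -
  have dom: "edom f = {y. \<bar>f y\<bar> \<noteq> \<infinity>}"
    using f(3) by (auto simp: edom_def)
  have x': "x \<in> interior {y. \<bar>f y\<bar> \<noteq> \<infinity>}"
    using x by (simp add: dom)
  have fin: "\<bar>f x\<bar> \<noteq> \<infinity>"
    using interior_subset[THEN subsetD, OF x'] by (rule CollectD)
  then obtain a where a: "f x = ereal a" by auto
  obtain e M where e: "e > 0" and M: "\<And>z. norm (z - x) < e \<Longrightarrow> f z \<le> ereal M"
    using bounded_above_near_interior[OF f(1,2) x] by blast
  note dir = subgradient_in_direction[OF f(1,3) a e M]
  have "subdiff f x \<noteq> {}"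
    using dir[of 0 0] a by auto
  then obtain \<xi> where \<xi>: "subdiff f x = {\<xi>}"
    using smooth unfolding essentially_smooth_def dom_subdiff_def by blast
  have quot: "\<exists>T>0. \<forall>t. 0 < t \<longrightarrow> t < T \<longrightarrow> (\<exists>c. f (x + t *\<^sub>R h) = ereal c \<and>
      t * blinfun_apply \<xi> h \<le> c - a \<and> c - a < t * (blinfun_apply \<xi> h + r))" if "r > 0" for r h
  proof -
    \<comment> \<open>Otherwise \<open>dir\<close> would yield a subgradient that is larger at
      \<open>h\<close> than the only one.\<close>
    have "\<not> (\<forall>t c. t > 0 \<longrightarrow> f (x + t *\<^sub>R h) \<le> ereal c \<longrightarrow> t * (blinfun_apply \<xi> h + r) \<le> c - a)"
      using dir[of h "blinfun_apply \<xi> h + r"] \<xi> that by auto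
    then obtain T c where T: "T > 0" and c: "f (x + T *\<^sub>R h) \<le> ereal c"
      and less: "c - a < T * (blinfun_apply \<xi> h + r)"
      by (auto simp: not_le)
    have "\<exists>c. f (x + t *\<^sub>R h) = ereal c \<and>
      t * blinfun_apply \<xi> h \<le> c - a \<and> c - a < t * (blinfun_apply \<xi> h + r)" if t: "0 < t" "t < T" for t
    proof -
      \<comment> \<open>Convexity on the segment from \<open>x\<close> to \<open>x + T h\<close>
        transfers the slope bound from \<open>T\<close> to every smaller \<open>t\<close>.\<close>
      have "f ((1 - t / T) *\<^sub>R x + (t / T) *\<^sub>R (x + T *\<^sub>R h)) \<le> ereal ((1 - t / T) * a + (t / T) * c)"
        using t T a c by (intro econvexD_real[OF f(1)]) auto
      then have le: "f (x + t *\<^sub>R h) \<le> ereal (a + (t / T) * (c - a))"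
        using T by (simp add: algebra_simps diff_divide_distrib)
      then obtain d where d: "f (x + t *\<^sub>R h) = ereal d"
        using f(3)[of "x + t *\<^sub>R h"] by (cases "f (x + t *\<^sub>R h)") auto
      have "d - a \<le> (t / T) * (c - a)"
        using le d by simp
      also have "\<dots> < (t / T) * (T * (blinfun_apply \<xi> h + r))"
        using t T less by (intro mult_strict_left_mono) auto
      finally have "d - a < t * (blinfun_apply \<xi> h + r)"
        using T by simp
      moreover have "t * blinfun_apply \<xi> h \<le> d - a"
        using subdiffD[of \<xi> f x a "x + t *\<^sub>R h" d] \<xi> a d by (simp add: blinfun.scaleR_right)
      ultimately show ?thesis
        using d by blast
    qed
    then show ?thesis
      using T by blast
  qed
  have "((\<lambda>t. (real_of_ereal (f (x + t *\<^sub>R h)) - real_of_ereal (f x)) / t)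
      \<longlongrightarrow> blinfun_apply \<xi> h) (at 0)" for h
  proof (rule LIM_I)
    fix r :: real assume r: "0 < r"
    obtain T where T: "T > 0" and Th: "\<And>t. 0 < t \<Longrightarrow> t < T \<Longrightarrow> \<exists>c. f (x + t *\<^sub>R h) = ereal c \<and>
      t * blinfun_apply \<xi> h \<le> c - a \<and> c - a < t * (blinfun_apply \<xi> h + r)"
      using quot[OF r, of h] by blast
    \<comment> \<open>For \<open>t < 0\<close> the quotient along \<open>h\<close> is the negative
      of the quotient along \<open>- h\<close> at \<open>- t\<close>.\<close>
    obtain T' where T': "T' > 0" and Th': "\<And>t. 0 < t \<Longrightarrow> t < T' \<Longrightarrow> \<exists>c. f (x + t *\<^sub>R (- h)) = ereal c \<and>
      t * blinfun_apply \<xi> (- h) \<le> c - a \<and> c - a < t * (blinfun_apply \<xi> (- h) + r)"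
      using quot[OF r, of "- h"] by blast
    have "norm ((real_of_ereal (f (x + t *\<^sub>R h)) - real_of_ereal (f x)) / t - blinfun_apply \<xi> h) < r"
      if t: "t \<noteq> 0" "norm (t - 0) < min T T'" for t
    proof (cases "t > 0")
      case True
      then obtain c where "f (x + t *\<^sub>R h) = ereal c"
        "t * blinfun_apply \<xi> h \<le> c - a" "c - a < t * (blinfun_apply \<xi> h + r)"
        using Th[of t] t by auto
      moreover from this have "blinfun_apply \<xi> h \<le> (c - a) / t" "(c - a) / t < blinfun_apply \<xi> h + r"
        using True by (auto simp: field_simps)
      ultimately show ?thesis
        using a by simp
    next
      case False
      then obtain c where "f (x + t *\<^sub>R h) = ereal c"
        "(- t) * blinfun_apply \<xi> (- h) \<le> c - a" "c - a < (- t) * (blinfun_apply \<xi> (- h) + r)"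
        using Th'[of "- t"] t by auto
      moreover from this have "(c - a) / t \<le> blinfun_apply \<xi> h" "blinfun_apply \<xi> h - r < (c - a) / t"
        using False t(1) by (auto simp: field_simps blinfun.minus_right)
      ultimately show ?thesis
        using a by simp
    qed
    then show "\<exists>s>0. \<forall>t. t \<noteq> 0 \<and> norm (t - 0) < s \<longrightarrow>
        norm ((real_of_ereal (f (x + t *\<^sub>R h)) - real_of_ereal (f x)) / t - blinfun_apply \<xi> h) < r"
      using T T' by (intro exI[of _ "min T T'"]) auto
  qed
  then have "has_gateaux f \<xi> x"
    by (intro iffD2[OF has_gateaux_iff_real[OF eventually_finite_along_line[OF x'] fin]] allI)
  then show ?thesis using \<xi> by blast
qed

section \<open>Bregman proximal steps\<close>

text \<open>The sum rule gives a subgradient of \<open>F\<close> at \<open>x'\<close>. By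
  \<open>dom\<close> this already puts \<open>x'\<close> in the interior of the domain of
  \<open>\<phi>\<close>, where the derivative is the only subgradient of \<open>\<phi>\<close>. The
  step can therefore be repeated from \<open>x'\<close>.\<close>

lemma bregman_prox_step:
  fixes F \<phi> :: "'a::banach \<Rightarrow> ereal" and l \<eta> :: "'a \<Rightarrow>\<^sub>L real"
  assumes F: "econvex F" "\<And>y. F y \<noteq> - \<infinity>"
    and \<phi>: "econvex \<phi>" "elsc \<phi>" "\<And>y. \<phi> y \<noteq> - \<infinity>" "essentially_smooth \<phi>"
    and dom: "dom_subdiff F \<subseteq> interior (edom \<phi>)"
    and x: "x \<in> dom_subdiff F" and \<tau>: "\<tau> > 0" and \<eta>: "has_gateaux \<phi> \<eta> x"
    and min: "is_arg_min (\<lambda>y. F y + ereal (blinfun_apply l y + c) + ereal (1 / \<tau>) * bregman \<phi> y x)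
      (\<lambda>_. True) x'"
  shows "\<exists>\<eta>'. has_gateaux \<phi> \<eta>' x' \<and> - (l + (1 / \<tau>) *\<^sub>R (\<eta>' - \<eta>)) \<in> subdiff F x'"
proof -
  \<comment> \<open>Up to a constant, the objective is \<open>F\<close> plus a multiple of
    \<open>\<phi>\<close> plus this linear functional, which absorbs the linear part of the Bregman
    distance.\<close>
  define l' where "l' = l - (1 / \<tau>) *\<^sub>R \<eta>"
  define obj where "obj y = F y + ereal (blinfun_apply l y + c) + ereal (1 / \<tau>) * bregman \<phi> y x" for y
  have le: "obj x' \<le> obj y" for y
    using min unfolding is_arg_min_def obj_def by (auto simp: not_less)
  obtain s where s: "\<phi> x = ereal s"
    using \<eta> by (cases "\<phi> x") (auto simp: has_gateaux_def)
  define k where "k = c - (1 / \<tau>) * (s - blinfun_apply \<eta> x)"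
  have obj: "obj y = ereal (a + (1 / \<tau>) * b + blinfun_apply l' y + k)"
    if "F y = ereal a" "\<phi> y = ereal b" for y a b
    using that \<tau> s by (simp add: obj_def bregman_eq[OF \<eta>] l'_def k_def blinfun.diff_left
        blinfun.scaleR_left blinfun.diff_right field_simps)
  obtain fx where fx: "F x = ereal fx"
    using dom_subdiff_finite[OF x] by (cases "F x") auto
  have "obj x' < \<infinity>"
    using le[of x] obj[OF fx s] by auto
  then have fin: "F x' < \<infinity> \<and> \<phi> x' < \<infinity>"
    using \<tau> s F(2)[of x'] \<phi>(3)[of x']
    by (cases "F x'"; cases "\<phi> x'") (auto simp: obj_def bregman_eq[OF \<eta>])
  obtain a b where ab: "F x' = ereal a" "\<phi> x' = ereal b"
    using fin F(2)[of x'] \<phi>(3)[of x'] by (cases "F x'"; cases "\<phi> x'") auto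
  have opt: "a + (1 / \<tau>) * b + blinfun_apply l' x' \<le> cy + (1 / \<tau>) * dy + blinfun_apply l' y"
    if le': "F y \<le> ereal cy" "\<phi> y \<le> ereal dy" for y cy dy
  proof -
    obtain a' b' where y: "F y = ereal a'" "\<phi> y = ereal b'"
      using le' F(2)[of y] \<phi>(3)[of y] by (cases "F y"; cases "\<phi> y") auto
    have "a + (1 / \<tau>) * b + blinfun_apply l' x' \<le> a' + (1 / \<tau>) * b' + blinfun_apply l' y"
      using le[of y] obj[OF ab] obj[OF y] by simp
    also have "\<dots> \<le> cy + (1 / \<tau>) * dy + blinfun_apply l' y"
      using le' y \<tau> by (intro add_mono mult_left_mono) auto
    finally show ?thesis .
  qed
  \<comment> \<open>The qualification of the sum rule holds at the old point \<open>x\<close>: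
    \<open>F\<close> is finite there and \<open>\<phi>\<close> is bounded above nearby.\<close>
  have "x \<in> interior (edom \<phi>)" using dom x by blast
  then obtain e M where e: "e > 0" and M: "\<And>z. norm (z - x) < e \<Longrightarrow> \<phi> z \<le> ereal M"
    using bounded_above_near_interior[OF \<phi>(1,2)] by blast
  have "F x < \<infinity>" "1 / \<tau> > 0" using fx \<tau> by auto
  then obtain \<xi> where \<xi>: "\<xi> \<in> subdiff \<phi> x'" and sub: "- (l' + (1 / \<tau>) *\<^sub>R \<xi>) \<in> subdiff F x'"
    using fermat_rule_convex_sum[OF F \<phi>(1,3) _ ab opt _ e M] by blast
  from sub have "x' \<in> interior (edom \<phi>)"
    using dom unfolding dom_subdiff_def by blast
  then obtain \<eta>' where \<eta>': "has_gateaux \<phi> \<eta>' x'" "subdiff \<phi> x' = {\<eta>'}"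
    using gateaux_on_interior[OF \<phi>] by blast
  have "l' + (1 / \<tau>) *\<^sub>R \<xi> = l + (1 / \<tau>) *\<^sub>R (\<eta>' - \<eta>)"
    using \<xi> \<eta>'(2) by (simp add: l'_def scaleR_diff_right)
  with sub \<eta>'(1) show ?thesis by auto
qed

section \<open>Error accumulation\<close>

text \<open>Divided by \<open>x + y\<close>, both arguments lie in [0, 1], where raising to a power
  \<open>s \<le> 1\<close> does not decrease them.\<close>

lemma powr_subadditive:
  fixes x y s :: real
  assumes "0 \<le> x" "0 \<le> y" "0 < s" "s \<le> 1"
  shows "(x + y) powr s \<le> x powr s + y powr s"
proof (cases "x + y = 0")
  case True
  then show ?thesis using assms by simp
next
  case False
  then have pos: "x + y > 0" using assms by simp
  have ge: "z / (x + y) \<le> (z / (x + y)) powr s" if "0 \<le> z" "z \<le> x + y" for z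
    using powr_mono'[of s 1 "z / (x + y)"] that assms pos by simp
  have "1 = x / (x + y) + y / (x + y)"
    using pos by (simp flip: add_divide_distrib)
  also have "\<dots> \<le> (x / (x + y)) powr s + (y / (x + y)) powr s"
    using assms by (intro add_mono ge) auto
  also have "\<dots> = (x powr s + y powr s) / (x + y) powr s"
    using assms by (simp add: powr_divide add_divide_distrib)
  finally show ?thesis
    using pos by (simp add: field_simps)
qed

lemma conjugate_exponent_quotient:
  fixes p q :: real
  assumes "p > 1" "q > 1" "1 / p + 1 / q = 1"
  shows "p / q = p - 1"
proof -
  have "p * (1 / p) + p * (1 / q) = p * 1"
    using assms(3) by (metis distrib_left)
  then show ?thesis using assms(1,2) by simp
qed

text \<open>Young's inequality after moving the factor \<open>m powr (1 / q)\<close> from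
  \<open>a\<close> to \<open>b\<close>.\<close>

lemma young_weighted:
  fixes p q :: real
  assumes pq: "p > 1" "q > 1" "1 / p + 1 / q = 1" and "a \<ge> 0" "b \<ge> 0" "m > 0"
  shows "a * b \<le> a powr p * m powr (- (p / q)) / p + m * b powr q / q"
proof -
  have "a * b = (a * m powr (- (1 / q))) * (m powr (1 / q) * b)"
    using assms by (simp add: powr_minus)
  also have "\<dots> \<le> (a * m powr (- (1 / q))) powr p / p + (m powr (1 / q) * b) powr q / q"
    using assms by (intro Youngs_inequality) auto
  also have "\<dots> = a powr p * m powr (- (p / q)) / p + m * b powr q / q"
    using assms by (simp add: powr_mult powr_powr)
  finally show ?thesis .
qed

text \<open>Young's inequality with weight \<open>c\<close> absorbs \<open>E * M\<close> into the
  fraction \<open>1 / q\<close> of the left-hand side; the fraction \<open>1 / p\<close> remains.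
  The \<open>q\<close>-th root of the resulting sum is split by subadditivity.\<close>

lemma powr_linear_growth_bound:
  fixes p q :: real
  assumes pq: "p > 1" "q > 1" "1 / p + 1 / q = 1" and nn: "A \<ge> 0" "E \<ge> 0" "M \<ge> 0" and c: "c > 0"
    and le: "c * M powr q \<le> A + E * M"
  shows "M \<le> (p * A / c) powr (1 / q) + (E / c) powr (p / q)"
proof -
  have pq1: "p / q = p - 1"
    using conjugate_exponent_quotient[OF pq] .
  have "E * M \<le> E powr p * c powr (- (p / q)) / p + c * M powr q / q"
    using young_weighted[OF pq nn(2,3) c] .
  with le have "c * M powr q * (1 - 1 / q) \<le> A + E powr p * c powr (- (p / q)) / p"
    by (simp add: algebra_simps)
  moreover have "1 - 1 / q = 1 / p" using pq by simp
  ultimately have "c * M powr q \<le> p * A + E powr p * c powr (- (p / q))"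
    using pq by (simp add: field_simps)
  then have "M powr q \<le> p * A / c + E powr p * (c powr (- (p / q)) / c)"
    using c by (simp add: field_simps)
  also have "c powr (- (p / q)) / c = c powr (- p)"
    using c powr_diff[of c "- (p / q)" 1] by (simp add: pq1)
  also have "E powr p * c powr (- p) = (E / c) powr p"
    using c nn by (simp add: powr_minus powr_divide field_simps)
  finally have "(M powr q) powr (1 / q) \<le> (p * A / c + (E / c) powr p) powr (1 / q)"
    using pq by (intro powr_mono2) auto
  also have "\<dots> \<le> (p * A / c) powr (1 / q) + ((E / c) powr p) powr (1 / q)"
    using pq nn c by (intro powr_subadditive) auto
  finally show ?thesis
    using pq nn by (simp add: powr_powr)
qed

text \<open>The step size condition says \<open>A + L < \<mu>1 / \<tau>\<close>, where
  \<open>A\<close> is the coefficient of the primal term when Young's inequality spends the whole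
  dual term. Being strict, it allows spending only a fraction \<open>\<theta> < 1\<close>; the
  remaining dual term gives \<open>c\<close>.\<close>

lemma bilinear_term_absorbed:
  fixes p q :: real
  assumes pq: "p > 1" "q > 1" "1 / p + 1 / q = 1" and pos: "\<tau> > 0" "\<sigma> > 0" "\<mu>2 > 0" "nK \<ge> 0"
    and step: "\<tau> * (\<sigma> powr (p - 1) * nK powr p + \<mu>2 powr (p - 1) * L) < \<mu>1 * \<mu>2 powr (p - 1)"
  shows "\<exists>c>0. \<forall>a\<ge>0. \<forall>b\<ge>0. c * b powr q \<le>
    \<mu>1 / (\<tau> * p) * a powr p + \<mu>2 / (\<sigma> * q) * b powr q - nK * a * b - L / p * a powr p"
proof -
  have pq1: "p / q = p - 1"
    using conjugate_exponent_quotient[OF pq] .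
  define m where "m = \<mu>2 / \<sigma>"
  have m: "m > 0" using pos by (simp add: m_def)
  define A where "A = m powr (- (p - 1)) * nK powr p"
  have A0: "A \<ge> 0" by (simp add: A_def)
  have mu: "\<mu>2 powr (p - 1) > 0" using pos by simp
  have "A = \<sigma> powr (p - 1) * nK powr p / \<mu>2 powr (p - 1)"
    unfolding A_def m_def powr_minus_divide using pos by (simp add: powr_divide)
  then have "\<sigma> powr (p - 1) * nK powr p = A * \<mu>2 powr (p - 1)"
    using mu by simp
  then have "(\<tau> * (A + L)) * \<mu>2 powr (p - 1) < \<mu>1 * \<mu>2 powr (p - 1)"
    using step by (simp add: algebra_simps)
  then have "\<tau> * (A + L) < \<mu>1"
    using mu by simp
  then have AL: "A + L < \<mu>1 / \<tau>"
    using pos by (simp add: pos_less_divide_eq mult.commute)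
  have "\<exists>\<rho>>1. \<rho> * A + L \<le> \<mu>1 / \<tau>"
  proof (cases "A = 0")
    case True
    then show ?thesis using AL by (intro exI[of _ 2]) auto
  next
    case False
    then show ?thesis
      \<comment> \<open>This \<open>\<rho>\<close> turns the inequality into an equality.\<close>
      using A0 AL by (intro exI[of _ "(\<mu>1 / \<tau> - L) / A"]) (auto simp: field_simps)
  qed
  then obtain \<rho> where \<rho>: "\<rho> > 1" "\<rho> * A + L \<le> \<mu>1 / \<tau>" by blast
  \<comment> \<open>Chosen so that the dual weight \<open>m * \<theta>\<close> multiplies the primal
    coefficient \<open>A\<close> by exactly \<open>\<rho>\<close>.\<close>
  define \<theta> where "\<theta> = \<rho> powr (- (1 / (p - 1)))"
  have \<theta>: "0 < \<theta>" "\<theta> < 1"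
    using \<rho> pq by (auto simp: \<theta>_def powr_minus inverse_less_1_iff intro!: gr_one_powr)
  have \<theta>\<rho>: "\<theta> powr (- (p - 1)) = \<rho>"
  proof -
    have "1 / (p - 1) * (p - 1) = 1" using pq(1) by simp
    then show ?thesis
      unfolding \<theta>_def powr_powr minus_mult_minus using \<rho>(1) by (simp only: powr_one)
  qed
  have "m * (1 - \<theta>) / q * b powr q \<le>
    \<mu>1 / (\<tau> * p) * a powr p + \<mu>2 / (\<sigma> * q) * b powr q - nK * a * b - L / p * a powr p"
    if "a \<ge> 0" "b \<ge> 0" for a b
  proof -
    have "(nK * a) * b \<le> (nK * a) powr p * (m * \<theta>) powr (- (p / q)) / p + (m * \<theta>) * b powr q / q"
      using pos m \<theta> that by (intro young_weighted[OF pq]) auto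
    also have "(nK * a) powr p * (m * \<theta>) powr (- (p / q)) = \<rho> * A * a powr p"
      using pos m \<theta> that \<theta>\<rho> by (simp add: pq1 powr_mult A_def)
    finally have "nK * a * b \<le> \<rho> * A * a powr p / p + (m * \<theta>) * b powr q / q" .
    moreover have "\<rho> * A * a powr p / p + L / p * a powr p = (\<rho> * A + L) * (a powr p / p)"
      by (simp add: algebra_simps add_divide_distrib)
    moreover have "(\<rho> * A + L) * (a powr p / p) \<le> \<mu>1 / \<tau> * (a powr p / p)"
      using \<rho>(2) pq by (intro mult_right_mono) auto
    moreover have "\<mu>2 / (\<sigma> * q) * b powr q = m * \<theta> * b powr q / q + m * (1 - \<theta>) / q * b powr q"
      using pos pq by (simp add: m_def field_simps)
    ultimately show ?thesis by (simp add: algebra_simps)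
  qed
  moreover have "m * (1 - \<theta>) / q > 0" using m \<theta> pq by simp
  ultimately show ?thesis by blast
qed

lemma avg_Suc:
  "avg x (Suc (Suc n)) =
    (1 - 1 / real (Suc (Suc n))) *\<^sub>R avg x (Suc n) + (1 / real (Suc (Suc n))) *\<^sub>R x (Suc (Suc n))"
proof -
  have "(1 - 1 / real (Suc (Suc n))) *\<^sub>R avg x (Suc n) = (1 / real (Suc (Suc n))) *\<^sub>R (\<Sum>k=1..Suc n. x k)"
    by (simp add: avg_def field_simps del: sum.cl_ivl_Suc)
  then show ?thesis
    by (simp add: avg_def scaleR_add_right)
qed

text \<open>Jensen's inequality by induction: the new mean is a convex combination of the old mean
  and the new term. The means start at index 1, hence the successors.\<close>

lemma econvex_avg:
  assumes f: "econvex f" and "\<And>k. f (x (Suc k)) \<le> ereal (a (Suc k))"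
  shows "f (avg x (Suc n)) \<le> ereal (avg a (Suc n))"
proof (induction n)
  case 0
  then show ?case using assms(2)[of 0] by (simp add: avg_def)
next
  case (Suc n)
  show ?case
    unfolding avg_Suc[of x n] avg_Suc[of a n] real_scaleR_def
    using Suc assms(2) by (intro econvexD_real[OF f]) auto
qed

text \<open>The accumulated error is at most \<open>E * n * M\<close>, with \<open>M\<close> the
  largest \<open>b k\<close> for \<open>k \<le> n\<close>. Telescoping up to the index where
  \<open>M\<close> is attained bounds \<open>c * M powr q\<close> by an affine function of
  \<open>M\<close>, hence \<open>M\<close> itself; telescoping up to \<open>n\<close> then bounds
  the sum.\<close>

lemma telescoping_error_bound:
  fixes p q :: real
  assumes pq: "p > 1" "q > 1" "1 / p + 1 / q = 1" and c: "c > 0" and E: "E \<ge> 0"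
    and b: "\<And>k. b k \<ge> 0" and d: "\<And>k. d k \<ge> 0"
    and lower: "\<And>k. c * b k powr q \<le> \<Delta> k"
    and step: "\<And>k. d (Suc k) \<le> \<Delta> k - \<Delta> (Suc k) + E * b (Suc k)"
  shows "(\<Sum>k=1..n. d k) \<le> \<Delta> 0 + E * real n * ((p * \<Delta> 0 / c) powr (1 / q) + (E * real n / c) powr (p / q))"
proof -
  have sum: "(\<Sum>k=1..m. d k) + \<Delta> m \<le> \<Delta> 0 + E * (\<Sum>k=1..m. b k)" for m
  proof (induction m)
    case (Suc m)
    then show ?case using step[of m] by (simp add: algebra_simps)
  qed simp
  define M where "M = Max (b ` {..n})"
  have le_M: "b k \<le> M" if "k \<le> n" for k
    unfolding M_def using that by (intro Max_ge) auto
  have M0: "M \<ge> 0" using le_M[of 0] b[of 0] by simp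
  have "M \<in> b ` {..n}" unfolding M_def by (intro Max_in) auto
  then obtain j where j: "j \<le> n" "b j = M" by auto
  have sum_b: "(\<Sum>k=1..m. b k) \<le> real n * M" if "m \<le> n" for m
  proof -
    have "(\<Sum>k=1..m. b k) \<le> (\<Sum>k=1..m. M)"
      using that by (intro sum_mono le_M) auto
    also have "\<dots> \<le> real n * M"
      using that M0 by (simp add: mult_right_mono)
    finally show ?thesis .
  qed
  have \<Delta>0: "\<Delta> k \<ge> 0" for k
    using lower[of k] c by (smt (verit) mult_nonneg_nonneg powr_ge_zero)
  have "c * M powr q \<le> \<Delta> j" using lower[of j] j by simp
  also have "\<dots> \<le> \<Delta> 0 + E * (\<Sum>k=1..j. b k)"
    using sum[of j] sum_nonneg[of "{1..j}" d] d by simp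
  also have "\<dots> \<le> \<Delta> 0 + E * (real n * M)"
    using sum_b[OF j(1)] E by (intro add_left_mono mult_left_mono) auto
  finally have "c * M powr q \<le> \<Delta> 0 + (E * real n) * M" by (simp add: mult_ac)
  then have M_le: "M \<le> (p * \<Delta> 0 / c) powr (1 / q) + (E * real n / c) powr (p / q)"
    using \<Delta>0 E M0 by (intro powr_linear_growth_bound[OF pq _ _ _ c]) auto
  have "(\<Sum>k=1..n. d k) \<le> \<Delta> 0 + E * (\<Sum>k=1..n. b k)"
    using sum[of n] \<Delta>0[of n] by simp
  also have "\<dots> \<le> \<Delta> 0 + E * (real n * M)"
    using sum_b[of n] E by (intro add_left_mono mult_left_mono) auto
  also have "\<dots> \<le> \<Delta> 0 + E * (real n * ((p * \<Delta> 0 / c) powr (1 / q) + (E * real n / c) powr (p / q)))"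
    using M_le E by (intro add_left_mono mult_left_mono) auto
  finally show ?thesis by (simp add: mult_ac)
qed

section \<open>Primal-dual descent\<close>

text \<open>A supremum of affine functions; points where \<open>f\<close> is infinite contribute
  only \<open>-\<infinity>\<close>.\<close>

lemma econvex_conj_fun:
  assumes "\<And>x. f x \<noteq> - \<infinity>"
  shows "econvex (conj_fun f)"
  unfolding econvex_def
proof (intro allI impI)
  fix v w :: "'a \<Rightarrow>\<^sub>L real" and t :: real
  assume t: "0 < t" "t < 1"
  let ?R = "ereal (1 - t) * conj_fun f v + ereal t * conj_fun f w"
  show "conj_fun f ((1 - t) *\<^sub>R v + t *\<^sub>R w) \<le> ?R"
    unfolding conj_fun_def[of f "(1 - t) *\<^sub>R v + t *\<^sub>R w"]
  proof (rule SUP_least)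
    fix x
    show "ereal (blinfun_apply ((1 - t) *\<^sub>R v + t *\<^sub>R w) x) - f x \<le> ?R"
    proof (cases "f x")
      case (real r)
      have "ereal (1 - t) * (ereal (blinfun_apply v x) - f x) + ereal t * (ereal (blinfun_apply w x) - f x) \<le> ?R"
        using t unfolding conj_fun_def
        by (intro add_mono ereal_mult_left_mono) (auto intro: SUP_upper)
      moreover have "ereal (blinfun_apply ((1 - t) *\<^sub>R v + t *\<^sub>R w) x) - f x =
          ereal (1 - t) * (ereal (blinfun_apply v x) - f x) + ereal t * (ereal (blinfun_apply w x) - f x)"
        using real by (simp add: blinfun.add_left blinfun.diff_left blinfun.scaleR_left algebra_simps)
      ultimately show ?thesis by simp
    qed (use assms in auto)
  qed
qed

lemma conj_fun_not_MInf:
  assumes "eproper f"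
  shows "conj_fun f v \<noteq> - \<infinity>"
proof -
  obtain x where x: "f x < \<infinity>" "f x \<noteq> - \<infinity>"
    using assms by (auto simp: eproper_def edom_def)
  then have "- \<infinity> < ereal (blinfun_apply v x) - f x"
    by (cases "f x") auto
  also have "\<dots> \<le> conj_fun f v"
    unfolding conj_fun_def by (rule SUP_upper) simp
  finally show ?thesis by auto
qed

lemma conj_fun_singleton: "conj_fun (indicator_fun {f}) v = ereal (blinfun_apply v f)"
proof (rule antisym)
  show "conj_fun (indicator_fun {f}) v \<le> ereal (blinfun_apply v f)"
    unfolding conj_fun_def by (rule SUP_least) (auto simp: indicator_fun_def)
  show "ereal (blinfun_apply v f) \<le> conj_fun (indicator_fun {f}) v"
    unfolding conj_fun_def by (rule SUP_upper2[of f]) (auto simp: indicator_fun_def zero_ereal_def)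
qed

text \<open>The conjugate is the linear evaluation at \<open>f\<close>, and a linear functional is
  its own only subgradient: the inequality is tested at \<open>w\<close> and
  \<open>- w\<close>.\<close>

lemma subdiff_conj_fun_singleton:
  assumes "\<zeta> \<in> subdiff (conj_fun (indicator_fun {f})) v"
  shows "blinfun_apply \<zeta> w = blinfun_apply w f"
proof -
  have le: "blinfun_apply \<zeta> y \<le> blinfun_apply y f" for y
    using subdiffD[OF assms conj_fun_singleton, of "v + y" "blinfun_apply (v + y) f"]
    by (simp add: conj_fun_singleton blinfun.add_left)
  show ?thesis
    using le[of w] le[of "- w"] by (simp add: blinfun.minus_left blinfun.minus_right)
qed

lemma convex_edom:
  assumes f: "econvex f"
  shows "convex (edom f)"
proof (rule convexI)
  fix x y and s t :: real
  assume xy: "x \<in> edom f" "y \<in> edom f" and st: "0 \<le> s" "0 \<le> t" "s + t = 1"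
  have bd: "\<exists>a. f z \<le> ereal a" if "z \<in> edom f" for z
    using that by (cases "f z") (auto simp: edom_def)
  obtain a b where "f x \<le> ereal a" "f y \<le> ereal b"
    using bd xy by blast
  then have "f (s *\<^sub>R x + t *\<^sub>R y) \<le> ereal (s * a + t * b)"
    using econvexD_real[OF f] st by blast
  then show "s *\<^sub>R x + t *\<^sub>R y \<in> edom f"
    unfolding edom_def by (auto intro: le_less_trans)
qed

text \<open>The sum stays below \<open>\<infinity>\<close> near \<open>z\<close>, and
  \<open>R\<close> never equals \<open>-\<infinity>\<close>, so \<open>G\<close> cannot be infinite
  there.\<close>

lemma interior_of_finite_sum:
  assumes c: "isCont (\<lambda>x. R x + G x) z" and fin: "R z < \<infinity>" "G z < \<infinity>" and R: "\<And>x. R x \<noteq> - \<infinity>"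
  shows "z \<in> interior (edom G)"
proof -
  have "R z + G z < \<infinity>" using fin by simp
  then have "eventually (\<lambda>x. R x + G x < \<infinity>) (nhds z)"
    using order_tendstoD(2)[OF c[unfolded continuous_at]]
    unfolding eventually_nhds_conv_at by blast
  then obtain S where S: "open S" "z \<in> S" "\<And>x. x \<in> S \<Longrightarrow> R x + G x < \<infinity>"
    unfolding eventually_nhds by blast
  have "S \<subseteq> edom G"
  proof
    fix x assume "x \<in> S"
    then show "x \<in> edom G"
      using S(3)[of x] R[of x] by (cases "R x"; cases "G x") (auto simp: edom_def)
  qed
  then show ?thesis
    using interiorI[OF S(1,2)] by blast
qed

text \<open>
  \<open>G\<close> need not be lower semicontinuous, so it could a priori jump up at a boundary point of its
  domain. A subgradient of \<open>R + G\<close> at \<open>x\<close> excludes this along the segment from \<open>x\<close> to an interior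
  point, since \<open>R\<close> cannot jump down there; the smoothness bound then passes to the limit.
\<close>

lemma smooth_bound_at_subgradient_point:
  fixes R G :: "'a::real_normed_vector \<Rightarrow> ereal"
  assumes R: "econvex R" "\<And>y. R y \<noteq> - \<infinity>" and G: "econvex G" "\<And>y. G y \<noteq> - \<infinity>"
    and smooth: "smooth_fun p L G" and p: "p > 0"
    and z: "z \<in> interior (edom G)" "R z < \<infinity>"
    and x: "\<xi> \<in> subdiff (\<lambda>x. R x + G x) x" "R x = ereal r" "G x = ereal g"
    and y: "y \<in> interior (edom G)" "has_gateaux G \<gamma> y" "G y = ereal gy"
  shows "g - gy - blinfun_apply \<gamma> (x - y) \<le> L / p * norm (x - y) powr p"
proof -
  obtain rz where rz: "R z = ereal rz"
    using z(2) R(2)[of z] by (cases "R z") auto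
  define X where "X t = x + t *\<^sub>R (z - x)" for t :: real
  \<comment> \<open>The subgradient inequality at \<open>X t\<close> and convexity of
    \<open>R\<close> give \<open>G (X t) \<ge> g + t * \<kappa>\<close>.\<close>
  define \<kappa> where "\<kappa> = r - rz + blinfun_apply \<xi> (z - x)"
  have "g + t * \<kappa> - gy - blinfun_apply \<gamma> (X t - y) \<le> L / p * norm (X t - y) powr p"
    if t: "0 < t" "t < 1" for t
  proof -
    have X: "X t = (1 - t) *\<^sub>R x + t *\<^sub>R z" by (simp add: X_def algebra_simps)
    obtain e where e: "e > 0" "ball z e \<subseteq> edom G"
      using z(1) by (auto simp: mem_interior)
    \<comment> \<open>The homothety with centre \<open>x\<close> and ratio \<open>t\<close> maps the
      ball around \<open>z\<close> onto this one.\<close>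
    have "ball (X t) (t * e) \<subseteq> edom G"
    proof
      fix w assume w: "w \<in> ball (X t) (t * e)"
      define w' where "w' = z + (1 / t) *\<^sub>R (w - X t)"
      have "dist z w' = (1 / t) * norm (w - X t)"
        using t by (simp add: w'_def dist_norm)
      then have "w' \<in> ball z e"
        using w t by (simp add: dist_norm norm_minus_commute pos_divide_less_eq mult.commute)
      moreover have "w = (1 - t) *\<^sub>R x + t *\<^sub>R w'"
        using t by (simp add: w'_def X scaleR_add_right)
      moreover have "x \<in> edom G" using x(3) by (simp add: edom_def)
      ultimately show "w \<in> edom G"
        using convexD[OF convex_edom[OF G(1)], of x w' "1 - t" t] e t by auto
    qed
    then have Xi: "X t \<in> interior (edom G)"
      using e t unfolding mem_interior by (intro exI[of _ "t * e"]) auto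
    then have "X t \<in> edom G" using interior_subset by blast
    then obtain gt where gt: "G (X t) = ereal gt"
      using G(2)[of "X t"] by (cases "G (X t)") (auto simp: edom_def)
    have Rt: "R (X t) \<le> ereal ((1 - t) * r + t * rz)"
      unfolding X using t x(2) rz by (intro econvexD_real[OF R(1)]) auto
    have "R (X t) + G (X t) \<le> ereal ((1 - t) * r + t * rz + gt)"
      using add_right_mono[OF Rt, of "G (X t)"] by (simp add: gt)
    then have "r + g + blinfun_apply \<xi> (X t - x) \<le> (1 - t) * r + t * rz + gt"
      using subdiffD[OF x(1), of "r + g" "X t"] x(2,3) by simp
    then have "g + t * \<kappa> \<le> gt"
      by (simp add: X_def \<kappa>_def blinfun.scaleR_right blinfun.diff_right algebra_simps)
    moreover have "gt - gy - blinfun_apply \<gamma> (X t - y) \<le> L / p * norm (X t - y) powr p"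
      using smooth Xi y(1) bregman_eq[OF y(2), of "X t"] y(3) gt unfolding smooth_fun_def by fastforce
    ultimately show ?thesis by simp
  qed
  then have "eventually (\<lambda>t. g + t * \<kappa> - gy - blinfun_apply \<gamma> (X t - y)
      \<le> L / p * norm (X t - y) powr p) (at_right 0)"
    using eventually_at_right_real[of 0 1] by (auto elim: eventually_mono)
  moreover have X0: "(X \<longlongrightarrow> x + 0 *\<^sub>R (z - x)) (at_right 0)"
    unfolding X_def by (intro tendsto_intros)
  then have "((\<lambda>t. g + t * \<kappa> - gy - blinfun_apply \<gamma> (X t - y))
      \<longlongrightarrow> g + 0 * \<kappa> - gy - blinfun_apply \<gamma> (x - y)) (at_right 0)"
    by (intro tendsto_intros) (use X0 in simp)
  \<comment> \<open>As \<open>p > 0\<close>, the power is continuous at 0 too, which covers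
    \<open>x = y\<close>.\<close>
  moreover have "((\<lambda>t. L / p * norm (X t - y) powr p) \<longlongrightarrow> L / p * norm (x - y) powr p) (at_right 0)"
    using X0 p by (intro tendsto_intros tendsto_powr2) auto
  ultimately show ?thesis
    using tendsto_le[of "at_right (0::real)"] by fastforce
qed

text \<open>An infinite value of \<open>f\<close> makes the quotient infinite, while its limit is
  finite.\<close>

lemma gateaux_finite_along_line:
  assumes "has_gateaux f \<xi> x"
  shows "eventually (\<lambda>t. \<bar>f (x + t *\<^sub>R h)\<bar> \<noteq> \<infinity>) (at (0::real))"
proof -
  let ?q = "\<lambda>t. (f (x + t *\<^sub>R h) - f x) / ereal t"
  obtain a where a: "f x = ereal a"
    using assms by (cases "f x") (auto simp: has_gateaux_def)
  have "(?q \<longlongrightarrow> ereal (blinfun_apply \<xi> h)) (at 0)"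
    using assms by (simp add: has_gateaux_def)
  then have "eventually (\<lambda>t. ?q t < \<infinity>) (at 0)" "eventually (\<lambda>t. - \<infinity> < ?q t) (at 0)"
    by (rule order_tendstoD; simp)+
  moreover have "eventually (\<lambda>t. t \<noteq> (0::real)) (at 0)"
    by (simp add: eventually_at_filter)
  ultimately show ?thesis
  proof eventually_elim
    case (elim t)
    then show ?case
      using a by (cases "f (x + t *\<^sub>R h)"; cases "t > 0") (auto simp: divide_ereal_def)
  qed
qed

lemma gateaux_tendsto_real:
  assumes "has_gateaux f \<xi> x"
  shows "((\<lambda>t. (real_of_ereal (f (x + t *\<^sub>R h)) - real_of_ereal (f x)) / t)
    \<longlongrightarrow> blinfun_apply \<xi> h) (at 0)"
proof -
  have "\<bar>f x\<bar> \<noteq> \<infinity>" using assms by (simp add: has_gateaux_def)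
  from iffD1[OF has_gateaux_iff_real[OF gateaux_finite_along_line[OF assms] this] assms]
  show ?thesis by blast
qed

lemma bounded_linear_eval: "bounded_linear (\<lambda>w :: 'b::real_normed_vector \<Rightarrow>\<^sub>L real. blinfun_apply w z)"
  by (rule blinfun.bounded_linear_left)

text \<open>The derivative comes straight from the difference quotients, as \<open>B\<close>
  subtracts \<open>G\<close> and a bilinear term. The formula for \<open>\<Xi>\<close> serves to
  expand the Bregman distance of \<open>B\<close>.\<close>

lemma has_gateaux_B_fun:
  assumes \<phi>: "has_gateaux \<phi> \<eta> u" and \<psi>: "has_gateaux \<psi> \<theta> v" and G: "has_gateaux G \<gamma> u"
  shows "\<exists>\<Xi>. has_gateaux (B_fun G K \<phi> \<psi> \<tau> \<sigma>) \<Xi> (u, v) \<and>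
    (\<forall>h k. blinfun_apply \<Xi> (h, k) = 1 / \<tau> * blinfun_apply \<eta> h + 1 / \<sigma> * blinfun_apply \<theta> k
      - (blinfun_apply v (blinfun_apply K h) + blinfun_apply k (blinfun_apply K u)) - blinfun_apply \<gamma> h)"
proof -
  let ?B = "B_fun G K \<phi> \<psi> \<tau> \<sigma>"
  define D where "D hk = 1 / \<tau> * blinfun_apply \<eta> (fst hk) + 1 / \<sigma> * blinfun_apply \<theta> (snd hk)
      - (blinfun_apply v (blinfun_apply K (fst hk)) + blinfun_apply (snd hk) (blinfun_apply K u))
      - blinfun_apply \<gamma> (fst hk)" for hk
  have "bounded_linear D"
    unfolding D_def
    by (intro bounded_linear_sub bounded_linear_add bounded_linear_mult_right[THEN bounded_linear_compose]
        bounded_linear_fst bounded_linear_snd bounded_linear_compose[OF blinfun.bounded_linear_right]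
        bounded_linear_compose[OF bounded_linear_eval])
  then have D: "blinfun_apply (Blinfun D) = D"
    by (rule bounded_linear_Blinfun_apply)
  have fin0: "\<bar>\<phi> u\<bar> \<noteq> \<infinity>" "\<bar>\<psi> v\<bar> \<noteq> \<infinity>" "\<bar>G u\<bar> \<noteq> \<infinity>"
    using assms by (auto simp: has_gateaux_def)
  have real_B: "?B (x, y) = ereal (1 / \<tau> * real_of_ereal (\<phi> x) + 1 / \<sigma> * real_of_ereal (\<psi> y)
      - blinfun_apply y (blinfun_apply K x) - real_of_ereal (G x))"
    if "\<bar>\<phi> x\<bar> \<noteq> \<infinity>" "\<bar>\<psi> y\<bar> \<noteq> \<infinity>" "\<bar>G x\<bar> \<noteq> \<infinity>" for x y
    using that by (cases "\<phi> x"; cases "\<psi> y"; cases "G x") (auto simp: B_fun_def)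
  have fin: "eventually (\<lambda>t. \<bar>\<phi> (u + t *\<^sub>R h)\<bar> \<noteq> \<infinity> \<and> \<bar>\<psi> (v + t *\<^sub>R k)\<bar> \<noteq> \<infinity> \<and> \<bar>G (u + t *\<^sub>R h)\<bar> \<noteq> \<infinity>)
      (at (0::real))" for h k
    using gateaux_finite_along_line[OF \<phi>] gateaux_finite_along_line[OF \<psi>]
      gateaux_finite_along_line[OF G] by (intro eventually_conj)
  have finB: "eventually (\<lambda>t. \<bar>?B ((u, v) + t *\<^sub>R hk)\<bar> \<noteq> \<infinity>) (at (0::real))" for hk
    using fin[of "fst hk" "snd hk"]
  proof eventually_elim
    case (elim t)
    then show ?case
      using real_B[of "u + t *\<^sub>R fst hk" "v + t *\<^sub>R snd hk"] by (cases hk) simp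
  qed
  have "((\<lambda>t. (real_of_ereal (?B ((u, v) + t *\<^sub>R hk)) - real_of_ereal (?B (u, v))) / t)
      \<longlongrightarrow> D hk) (at 0)" for hk
  proof -
    obtain h k where hk: "hk = (h, k)" by (cases hk)
    \<comment> \<open>The bilinear part contributes the second-order term
      \<open>t * k (K h)\<close>, which vanishes in the limit.\<close>
    have "((\<lambda>t. 1 / \<tau> * ((real_of_ereal (\<phi> (u + t *\<^sub>R h)) - real_of_ereal (\<phi> u)) / t)
        + 1 / \<sigma> * ((real_of_ereal (\<psi> (v + t *\<^sub>R k)) - real_of_ereal (\<psi> v)) / t)
        - (blinfun_apply v (blinfun_apply K h) + blinfun_apply k (blinfun_apply K u)
            + t * blinfun_apply k (blinfun_apply K h))
        - (real_of_ereal (G (u + t *\<^sub>R h)) - real_of_ereal (G u)) / t)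
      \<longlongrightarrow> 1 / \<tau> * blinfun_apply \<eta> h + 1 / \<sigma> * blinfun_apply \<theta> k
        - (blinfun_apply v (blinfun_apply K h) + blinfun_apply k (blinfun_apply K u)
            + 0 * blinfun_apply k (blinfun_apply K h)) - blinfun_apply \<gamma> h) (at 0)"
      by (intro tendsto_intros gateaux_tendsto_real \<phi> \<psi> G)
    then have lim: "((\<lambda>t. 1 / \<tau> * ((real_of_ereal (\<phi> (u + t *\<^sub>R h)) - real_of_ereal (\<phi> u)) / t)
        + 1 / \<sigma> * ((real_of_ereal (\<psi> (v + t *\<^sub>R k)) - real_of_ereal (\<psi> v)) / t)
        - (blinfun_apply v (blinfun_apply K h) + blinfun_apply k (blinfun_apply K u)
            + t * blinfun_apply k (blinfun_apply K h))
        - (real_of_ereal (G (u + t *\<^sub>R h)) - real_of_ereal (G u)) / t) \<longlongrightarrow> D hk) (at 0)"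
      by (simp add: D_def hk)
    have "eventually (\<lambda>t. t \<noteq> (0::real)) (at 0)"
      by (simp add: eventually_at_filter)
    with fin[of h k] have "eventually (\<lambda>t.
        1 / \<tau> * ((real_of_ereal (\<phi> (u + t *\<^sub>R h)) - real_of_ereal (\<phi> u)) / t)
        + 1 / \<sigma> * ((real_of_ereal (\<psi> (v + t *\<^sub>R k)) - real_of_ereal (\<psi> v)) / t)
        - (blinfun_apply v (blinfun_apply K h) + blinfun_apply k (blinfun_apply K u)
            + t * blinfun_apply k (blinfun_apply K h))
        - (real_of_ereal (G (u + t *\<^sub>R h)) - real_of_ereal (G u)) / t
      = (real_of_ereal (?B ((u, v) + t *\<^sub>R hk)) - real_of_ereal (?B (u, v))) / t) (at 0)"
    proof eventually_elim
      case (elim t)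
      have "?B ((u, v) + t *\<^sub>R hk) = ?B (u + t *\<^sub>R h, v + t *\<^sub>R k)"
        by (simp add: hk)
      moreover have "(blinfun_apply (v + t *\<^sub>R k) (blinfun_apply K (u + t *\<^sub>R h)) - blinfun_apply v (blinfun_apply K u)) / t
          = blinfun_apply v (blinfun_apply K h) + blinfun_apply k (blinfun_apply K u)
            + t * blinfun_apply k (blinfun_apply K h)"
        using elim by (simp add: blinfun.add_left blinfun.add_right blinfun.scaleR_left
            blinfun.scaleR_right field_simps)
      ultimately show ?case
        using real_B[of "u + t *\<^sub>R h" "v + t *\<^sub>R k"] real_B[OF fin0] elim
        by (simp add: diff_divide_distrib add_divide_distrib right_diff_distrib)
    qed
    from iffD1[OF tendsto_cong[OF this] lim] show ?thesis .
  qed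
  moreover have "\<bar>?B (u, v)\<bar> \<noteq> \<infinity>"
    by (simp add: real_B[OF fin0])
  ultimately have "has_gateaux ?B (Blinfun D) (u, v)"
    unfolding has_gateaux_iff_real[OF finB \<open>\<bar>?B (u, v)\<bar> \<noteq> \<infinity>\<close>] D by blast
  then show ?thesis
    by (intro exI[of _ "Blinfun D"]) (simp add: D D_def)
qed

text \<open>
  The three-point identity for the Bregman distance of \<open>B\<close>: the coupling terms left over from the
  two optimality conditions are exactly those produced by the bilinear part of \<open>B\<close>.
\<close>

lemma primal_dual_descent:
  fixes K :: "'a::real_normed_vector \<Rightarrow>\<^sub>L 'b::real_normed_vector"
    and v v' vs :: "'b \<Rightarrow>\<^sub>L real" and \<zeta>\<delta> :: "('b \<Rightarrow>\<^sub>L real) \<Rightarrow>\<^sub>L real"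
  assumes primal: "r' + blinfun_apply (- (\<gamma> + (v o\<^sub>L K) + \<kappa> *\<^sub>R (\<eta>' - \<eta>))) (us - u') \<le> rs"
    and dual: "h' + blinfun_apply (- (l + \<rho> *\<^sub>R (\<theta>' - \<theta>))) (vs - v') \<le> hs"
    and l: "\<And>w. blinfun_apply l w = - blinfun_apply w (blinfun_apply K (2 *\<^sub>R u' - u))"
    and G: "g' + blinfun_apply \<gamma>' (us - u') \<le> gs"
    and coupling: "0 \<le> \<kappa> * (s' - s - blinfun_apply \<eta> (u' - u)) + \<rho> * (t' - t - blinfun_apply \<theta> (v' - v))
      - blinfun_apply (v' - v) (blinfun_apply K (u' - u)) - (g' - g - blinfun_apply \<gamma> (u' - u))"
  shows "(r' + g' - (rs + gs) - blinfun_apply (- (vs o\<^sub>L K)) (u' - us))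
      + (h' - hs - blinfun_apply \<zeta>\<delta> (v' - vs))
    \<le> (\<kappa> * (ss - s - blinfun_apply \<eta> (us - u)) + \<rho> * (ts - t - blinfun_apply \<theta> (vs - v))
        - blinfun_apply (vs - v) (blinfun_apply K (us - u)) - (gs - g - blinfun_apply \<gamma> (us - u)))
      - (\<kappa> * (ss - s' - blinfun_apply \<eta>' (us - u')) + \<rho> * (ts - t' - blinfun_apply \<theta>' (vs - v'))
        - blinfun_apply (vs - v') (blinfun_apply K (us - u')) - (gs - g' - blinfun_apply \<gamma>' (us - u')))
      + (blinfun_apply \<zeta>\<delta> (vs - v') - blinfun_apply (vs - v') (blinfun_apply K us))"
proof -
  \<comment> \<open>An exact identity: right-hand side minus left-hand side is the sum of the four
    slacks in the assumed inequalities.\<close>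
  have "((\<kappa> * (ss - s - blinfun_apply \<eta> (us - u)) + \<rho> * (ts - t - blinfun_apply \<theta> (vs - v))
        - blinfun_apply (vs - v) (blinfun_apply K (us - u)) - (gs - g - blinfun_apply \<gamma> (us - u)))
      - (\<kappa> * (ss - s' - blinfun_apply \<eta>' (us - u')) + \<rho> * (ts - t' - blinfun_apply \<theta>' (vs - v'))
        - blinfun_apply (vs - v') (blinfun_apply K (us - u')) - (gs - g' - blinfun_apply \<gamma>' (us - u')))
      + (blinfun_apply \<zeta>\<delta> (vs - v') - blinfun_apply (vs - v') (blinfun_apply K us)))
    - ((r' + g' - (rs + gs) - blinfun_apply (- (vs o\<^sub>L K)) (u' - us))
      + (h' - hs - blinfun_apply \<zeta>\<delta> (v' - vs)))
    = (rs - (r' + blinfun_apply (- (\<gamma> + (v o\<^sub>L K) + \<kappa> *\<^sub>R (\<eta>' - \<eta>))) (us - u')))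
    + (hs - (h' + blinfun_apply (- (l + \<rho> *\<^sub>R (\<theta>' - \<theta>))) (vs - v')))
    + (gs - (g' + blinfun_apply \<gamma>' (us - u')))
    + (\<kappa> * (s' - s - blinfun_apply \<eta> (u' - u)) + \<rho> * (t' - t - blinfun_apply \<theta> (v' - v))
      - blinfun_apply (v' - v) (blinfun_apply K (u' - u)) - (g' - g - blinfun_apply \<gamma> (u' - u)))"
    by (simp add: l blinfun.add_left blinfun.diff_left blinfun.minus_left blinfun.scaleR_left
        blinfun.diff_right blinfun.scaleR_right blinfun.add_right blinfun.minus_right algebra_simps)
  with primal dual G coupling show ?thesis
    by linarith
qed

theorem theorem6p2:
  fixes K :: "'a::banach \<Rightarrow>\<^sub>L 'b::banach"
    and f f\<delta> :: 'b
    and H\<delta> :: "'b \<Rightarrow> ereal"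
    and R G \<phi> :: "'a \<Rightarrow> ereal"
    and G' :: "'a \<Rightarrow> 'a \<Rightarrow>\<^sub>L real"
    and \<psi> :: "('b \<Rightarrow>\<^sub>L real) \<Rightarrow> ereal"
    and p q \<delta> \<tau> \<sigma> L \<mu>1 \<mu>2 C :: real
    and ubar udag :: 'a
    and vdag :: "'b \<Rightarrow>\<^sub>L real"
    and \<zeta> \<zeta>\<delta> :: "('b \<Rightarrow>\<^sub>L real) \<Rightarrow>\<^sub>L real"
    and u :: "nat \<Rightarrow> 'a"
    and v :: "nat \<Rightarrow> 'b \<Rightarrow>\<^sub>L real"
  assumes "reflexive_space TYPE('a)" and "reflexive_space TYPE('b)"
    and "norm (f - f\<delta>) \<le> \<delta>"
    and "eproper H\<delta>" and "econvex H\<delta>" and "elsc H\<delta>"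
    and "eproper R" and "econvex R" and "elsc R"
    and pq: "p > 1" "q > 1" "1 / p + 1 / q = 1"
    and "eproper G" and "econvex G"
    and "\<And>x. x \<in> interior (edom G) \<Longrightarrow> has_frechet G (G' x) x"
    and "smooth_fun p L G"
    and "ubar \<in> edom (\<lambda>x. indicator_fun {f} (blinfun_apply K x)) \<inter> edom R \<inter> edom G"
    and "isCont (\<lambda>x. R x + G x) ubar"
    and solution: "blinfun_apply K udag = f"
      "\<And>x. blinfun_apply K x = f \<Longrightarrow> R udag + G udag \<le> R x + G x"
      "\<bar>R udag\<bar> \<noteq> \<infinity>" "\<bar>G udag\<bar> \<noteq> \<infinity>"
    and source: "- (vdag o\<^sub>L K) \<in> subdiff (\<lambda>x. R x + G x) udag"
    and "eproper \<phi>" and "econvex \<phi>" and "elsc \<phi>"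
    and "essentially_smooth \<phi>" and "essentially_strictly_convex \<phi>"
    and "dom_subdiff R \<subseteq> interior (edom \<phi>)"
    and "supercoercive R \<or> supercoercive \<phi>"
    and "\<mu>1 > 0" and "strongly_convex_fun p \<mu>1 \<phi>"
    and "eproper \<psi>" and "econvex \<psi>" and "elsc \<psi>"
    and "essentially_smooth \<psi>" and "essentially_strictly_convex \<psi>"
    and "dom_subdiff (conj_fun H\<delta>) \<subseteq> interior (edom \<psi>)"
    and "supercoercive (conj_fun H\<delta>) \<or> supercoercive \<psi>"
    and "\<mu>2 > 0" and "strongly_convex_fun q \<mu>2 \<psi>"
    and stepsize: "\<tau> > 0" "\<sigma> > 0"
      "\<tau> * (\<sigma> powr (p - 1) * norm K powr p + \<mu>2 powr (p - 1) * L) < \<mu>1 * \<mu>2 powr (p - 1)"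
    and algorithm: "condat_vu R G G' (conj_fun H\<delta>) K \<phi> \<psi> \<tau> \<sigma> u v"
      "u 0 \<in> interior (edom G) \<inter> dom_subdiff R" "v 0 \<in> dom_subdiff (conj_fun H\<delta>)"
    and "C > 0"
    and "\<zeta>\<delta> \<in> subdiff (conj_fun H\<delta>) vdag"
    and "\<zeta> \<in> subdiff (conj_fun (indicator_fun {f})) vdag"
    and "\<And>k. blinfun_apply (\<zeta>\<delta> - \<zeta>) (vdag - v k) \<le> C * \<delta> * norm (vdag - v k)"
  shows "\<exists>\<nu>>0. \<exists>Cbar>0. \<forall>n::nat. n \<ge> 1 \<longrightarrow>
    bregman_wrt (\<lambda>x. R x + G x) (- (vdag o\<^sub>L K)) (avg u n) udag
      + bregman_wrt (conj_fun H\<delta>) \<zeta>\<delta> (avg v n) vdag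
    \<le> ereal (1 / real n) * bregman (B_fun G K \<phi> \<psi> \<tau> \<sigma>) (udag, vdag) (u 0, v 0)
      + ereal (Cbar powr p * q powr (p / q) / \<nu> powr (p / q) * \<delta> powr p * real n powr (p - 1))
      + ereal C * epowr (ereal (p * q / \<nu>)
          * bregman (B_fun G K \<phi> \<psi> \<tau> \<sigma>) (udag, vdag) (u 0, v 0)) (1 / q) * ereal \<delta>"
proof -

  \<comment> \<open>Properties of the functions and the derivative of \<open>G\<close> at the
    iterates\<close>
  define Hs where "Hs = conj_fun H\<delta>"
  have R: "econvex R" "\<And>x. R x \<noteq> - \<infinity>" and G: "econvex G" "\<And>x. G x \<noteq> - \<infinity>"
    and \<phi>: "econvex \<phi>" "elsc \<phi>" "\<And>x. \<phi> x \<noteq> - \<infinity>" "essentially_smooth \<phi>"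
    and \<psi>: "econvex \<psi>" "elsc \<psi>" "\<And>x. \<psi> x \<noteq> - \<infinity>" "essentially_smooth \<psi>"
    using assms(7,8,13,14,24-27,33-36) by (simp_all add: eproper_def)
  have Hs: "econvex Hs" "\<And>x. Hs x \<noteq> - \<infinity>"
    using econvex_conj_fun[of H\<delta>] conj_fun_not_MInf[OF assms(4)] assms(4)
    by (simp_all add: Hs_def eproper_def)
  have domR: "dom_subdiff R \<subseteq> interior (edom \<phi>)" and domH: "dom_subdiff Hs \<subseteq> interior (edom \<psi>)"
    using assms(29,38) by (simp_all add: Hs_def)
  have \<delta>: "\<delta> \<ge> 0"
    using assms(3) norm_ge_zero order_trans by blast
  have alg: "has_frechet G (G' (u k)) (u k)"
    "is_arg_min
       (\<lambda>x. G (u k) + ereal (blinfun_apply (G' (u k)) (x - u k)) + R x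
            + ereal (blinfun_apply (v k) (blinfun_apply K x))
            + ereal (1 / \<tau>) * bregman \<phi> x (u k)) (\<lambda>_. True) (u (Suc k))"
    "is_arg_min
       (\<lambda>y. Hs y - ereal (blinfun_apply y (blinfun_apply K (2 *\<^sub>R u (Suc k) - u k)))
            + ereal (1 / \<sigma>) * bregman \<psi> y (v k)) (\<lambda>_. True) (v (Suc k))" for k
    using algorithm(1) unfolding condat_vu_def Hs_def by blast+
  define g where "g k = real_of_ereal (G (u k))" for k
  have u_int: "u k \<in> interior (edom G)" for k
  proof -
    have "{y. \<bar>G y\<bar> \<noteq> \<infinity>} = edom G"
      using G(2) by (auto simp: edom_def)
    then show ?thesis
      using alg(1)[of k] by (simp add: has_frechet_def)
  qed
  have g: "G (u k) = ereal (g k)" for k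
    using subsetD[OF interior_subset u_int[of k]] G(2)[of "u k"]
    by (cases "G (u k)") (auto simp: edom_def g_def)
  have \<gamma>: "has_gateaux G (G' (u k)) (u k)" for k
    using frechet_imp_gateaux[OF alg(1)] .
  have \<gamma>_sub: "G' (u k) \<in> subdiff G (u k)" for k
    using gateaux_in_subdiff[OF \<gamma> G] .

  \<comment> \<open>Optimality conditions of the primal and dual steps\<close>
  define l where "l k = G' (u k) + (v k o\<^sub>L K)" for k
  have primal: "\<exists>\<eta>'. has_gateaux \<phi> \<eta>' (u (Suc k)) \<and>
      - (l k + (1 / \<tau>) *\<^sub>R (\<eta>' - \<eta>)) \<in> subdiff R (u (Suc k))"
    if "u k \<in> dom_subdiff R" "has_gateaux \<phi> \<eta> (u k)" for k \<eta>
  proof (rule bregman_prox_step[OF R \<phi> domR that(1) stepsize(1) that(2)])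
    have "G (u k) + ereal (blinfun_apply (G' (u k)) (x - u k)) + R x
        + ereal (blinfun_apply (v k) (blinfun_apply K x))
      = R x + ereal (blinfun_apply (l k) x + (g k - blinfun_apply (G' (u k)) (u k)))" for x
      by (cases "R x") (auto simp: g l_def blinfun.add_left blinfun.diff_right)
    then show "is_arg_min (\<lambda>x. R x + ereal (blinfun_apply (l k) x + (g k - blinfun_apply (G' (u k)) (u k)))
        + ereal (1 / \<tau>) * bregman \<phi> x (u k)) (\<lambda>_. True) (u (Suc k))"
      using alg(2)[of k] by simp
  qed
  \<comment> \<open>The image of \<open>- K (2 u (k + 1) - u k)\<close> in the bidual, as the dual
    step lives on the dual space.\<close>
  define m :: "nat \<Rightarrow> ('b \<Rightarrow>\<^sub>L real) \<Rightarrow>\<^sub>L real" where "m k = Blinfun (\<lambda>w. - blinfun_apply w (blinfun_apply K (2 *\<^sub>R u (Suc k) - u k)))" for k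
  have m: "blinfun_apply (m k) w = - blinfun_apply w (blinfun_apply K (2 *\<^sub>R u (Suc k) - u k))" for k w
    unfolding m_def by (simp add: bounded_linear_Blinfun_apply bounded_linear_minus bounded_linear_eval)
  have dual: "\<exists>\<theta>'. has_gateaux \<psi> \<theta>' (v (Suc k)) \<and>
      - (m k + (1 / \<sigma>) *\<^sub>R (\<theta>' - \<theta>)) \<in> subdiff Hs (v (Suc k))"
    if "v k \<in> dom_subdiff Hs" "has_gateaux \<psi> \<theta> (v k)" for k \<theta>
  proof (rule bregman_prox_step[OF Hs \<psi> domH that(1) stepsize(2) that(2)])
    have "Hs y - ereal (blinfun_apply y (blinfun_apply K (2 *\<^sub>R u (Suc k) - u k)))
      = Hs y + ereal (blinfun_apply (m k) y + 0)" for y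
      by (cases "Hs y") (auto simp: m)
    then show "is_arg_min (\<lambda>y. Hs y + ereal (blinfun_apply (m k) y + 0)
        + ereal (1 / \<sigma>) * bregman \<psi> y (v k)) (\<lambda>_. True) (v (Suc k))"
      using alg(3)[of k] by simp
  qed
  have u_dom: "u k \<in> dom_subdiff R" for k
  proof (induction k)
    case 0
    then show ?case using algorithm(2) by blast
  next
    case (Suc k)
    then obtain \<eta> where "has_gateaux \<phi> \<eta> (u k)"
      using gateaux_on_interior[OF \<phi>] domR by blast
    then show ?case
      using primal[OF Suc] unfolding dom_subdiff_def by blast
  qed
  have v_dom: "v k \<in> dom_subdiff Hs" for k
  proof (induction k)
    case 0
    then show ?case using algorithm(3) by (simp add: Hs_def)
  next
    case (Suc k)
    then obtain \<theta> where "has_gateaux \<psi> \<theta> (v k)"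
      using gateaux_on_interior[OF \<psi>] domH by blast
    then show ?case
      using dual[OF Suc] unfolding dom_subdiff_def by blast
  qed
  have "\<forall>k. \<exists>\<eta>. has_gateaux \<phi> \<eta> (u k)" "\<forall>k. \<exists>\<theta>. has_gateaux \<psi> \<theta> (v k)"
    using gateaux_on_interior[OF \<phi>] gateaux_on_interior[OF \<psi>] domR domH u_dom v_dom by blast+
  then obtain \<eta> \<theta> where \<eta>: "\<And>k. has_gateaux \<phi> (\<eta> k) (u k)" and \<theta>: "\<And>k. has_gateaux \<psi> (\<theta> k) (v k)"
    by metis
  \<comment> \<open>Uniqueness of Gateaux derivatives identifies the one produced by step
    \<open>k\<close> with the chosen \<open>\<eta> (Suc k)\<close>.\<close>
  have primal_sub: "- (l k + (1 / \<tau>) *\<^sub>R (\<eta> (Suc k) - \<eta> k)) \<in> subdiff R (u (Suc k))" for k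
    using primal[OF u_dom \<eta>] has_gateaux_unique[OF \<eta>] by blast
  have dual_sub: "- (m k + (1 / \<sigma>) *\<^sub>R (\<theta> (Suc k) - \<theta> k)) \<in> subdiff Hs (v (Suc k))" for k
    using dual[OF v_dom \<theta>] has_gateaux_unique[OF \<theta>] by blast

  \<comment> \<open>Finite values at the iterates and at the solution\<close>
  define r s h t where "r k = real_of_ereal (R (u k))" and "s k = real_of_ereal (\<phi> (u k))"
    and "h k = real_of_ereal (Hs (v k))" and "t k = real_of_ereal (\<psi> (v k))" for k
  have r: "R (u k) = ereal (r k)" and s: "\<phi> (u k) = ereal (s k)"
    and h: "Hs (v k) = ereal (h k)" and t: "\<psi> (v k) = ereal (t k)" for k
    using dom_subdiff_finite[OF u_dom[of k]] dom_subdiff_finite[OF v_dom[of k]] \<eta>[of k] \<theta>[of k]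
    by (simp_all add: r_def s_def h_def t_def has_gateaux_def ereal_real')
  obtain rs gs where rs: "R udag = ereal rs" and gs: "G udag = ereal gs"
    using solution(3,4) by auto
  have vdag_dom: "vdag \<in> dom_subdiff Hs"
    using assms(49) by (auto simp: dom_subdiff_def Hs_def)
  obtain hs where hs: "Hs vdag = ereal hs"
    using dom_subdiff_finite[OF vdag_dom] by auto
  \<comment> \<open>The subgradient \<open>\<zeta>\<delta>\<close> makes \<open>\<psi>\<close>
    finite at \<open>vdag\<close>; finiteness of \<open>\<phi>\<close> at \<open>udag\<close> is
    left to a case distinction.\<close>
  have vdag_edom: "vdag \<in> edom \<psi>"
    using vdag_dom domH interior_subset by blast
  obtain ts where ts: "\<psi> vdag = ereal ts"
    using vdag_edom \<psi>(3)[of vdag] by (cases "\<psi> vdag") (auto simp: edom_def)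

  \<comment> \<open>The Bregman distance of \<open>B\<close> and its coercivity constant\<close>
  let ?B = "B_fun G K \<phi> \<psi> \<tau> \<sigma>"
  let ?W = "(udag, vdag)"
  define D where "D x y = bregman_wrt (\<lambda>x. R x + G x) (- (vdag o\<^sub>L K)) x udag
      + bregman_wrt Hs \<zeta>\<delta> y vdag" for x y
  obtain \<Xi> where \<Xi>: "has_gateaux ?B \<Xi> (u 0, v 0)"
    and \<Xi>_apply: "\<And>h k. blinfun_apply \<Xi> (h, k) = 1 / \<tau> * blinfun_apply (\<eta> 0) h + 1 / \<sigma> * blinfun_apply (\<theta> 0) k
      - (blinfun_apply (v 0) (blinfun_apply K h) + blinfun_apply k (blinfun_apply K (u 0)))
      - blinfun_apply (G' (u 0)) h"
    using has_gateaux_B_fun[OF \<eta> \<theta> \<gamma>] by metis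
  have B0: "?B (u 0, v 0) = ereal (1 / \<tau> * s 0 + 1 / \<sigma> * t 0
      - blinfun_apply (v 0) (blinfun_apply K (u 0)) - g 0)"
    by (simp add: B_fun_def s t g)

  obtain c where c: "c > 0" and coupling: "\<And>a b. a \<ge> 0 \<Longrightarrow> b \<ge> 0 \<Longrightarrow> c * b powr q \<le>
      \<mu>1 / (\<tau> * p) * a powr p + \<mu>2 / (\<sigma> * q) * b powr q - norm K * a * b - L / p * a powr p"
    using bilinear_term_absorbed[OF pq stepsize(1,2) assms(40) norm_ge_zero stepsize(3)] by blast

  \<comment> \<open>The estimate for fixed \<open>n\<close>\<close>
  have main: "D (avg u n) (avg v n)
    \<le> ereal (1 / real n) * bregman ?B ?W (u 0, v 0)
      + ereal (C powr p * q powr (p / q) / (q * c) powr (p / q) * \<delta> powr p * real n powr (p - 1))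
      + ereal C * epowr (ereal (p * q / (q * c)) * bregman ?B ?W (u 0, v 0)) (1 / q) * ereal \<delta>"
    if n: "n \<ge> 1" for n
  proof (cases "\<phi> udag")
    \<comment> \<open>Here the Bregman distance is infinite and the bound is trivial;
      \<open>\<delta> \<ge> 0\<close> and \<open>C > 0\<close> keep the last summand from being
      \<open>-\<infinity>\<close>.\<close>
    case PInf
    then have "?B ?W = \<infinity>"
      using stepsize(1) by (simp add: B_fun_def ts gs)
    then have "bregman ?B ?W (u 0, v 0) = \<infinity>"
      by (simp add: bregman_eq[OF \<Xi>] B0)
    moreover have "ereal (p * q / (q * c)) * \<infinity> = \<infinity>"
      using c pq by simp
    ultimately show ?thesis
      using n \<delta> assms(48) by (simp add: epowr_def)
  next
    case MInf
    then show ?thesis using \<phi>(3) by blast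
  next

    \<comment> \<open>Lower bound and descent for the Bregman distance\<close>
    case (real ss)
    \<comment> \<open>The Bregman distance of \<open>B\<close> from \<open>w k\<close> to the
      solution, expanded in real terms; the bilinear part contributes the pairing of the
      differences.\<close>
    define \<Delta> where "\<Delta> k = 1 / \<tau> * (ss - s k - blinfun_apply (\<eta> k) (udag - u k))
      + 1 / \<sigma> * (ts - t k - blinfun_apply (\<theta> k) (vdag - v k))
      - blinfun_apply (vdag - v k) (blinfun_apply K (udag - u k))
      - (gs - g k - blinfun_apply (G' (u k)) (udag - u k))" for k
    define d where "d k = (r k + g k - (rs + gs) - blinfun_apply (- (vdag o\<^sub>L K)) (u k - udag))
      + (h k - hs - blinfun_apply \<zeta>\<delta> (v k - vdag))" for k
    \<comment> \<open>Used at the solution, to bound \<open>\<Delta>\<close> below, and at the next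
      iterate, for the coupling term in the descent. The smoothness bound on \<open>G\<close> is a
      premise because the two cases obtain it differently.\<close>
    have B_lower: "c * norm (y - v k) powr q \<le> 1 / \<tau> * (sx - s k - blinfun_apply (\<eta> k) (x - u k))
      + 1 / \<sigma> * (ty - t k - blinfun_apply (\<theta> k) (y - v k))
      - blinfun_apply (y - v k) (blinfun_apply K (x - u k))
      - (gx - g k - blinfun_apply (G' (u k)) (x - u k))"
      if sx: "\<phi> x = ereal sx" and ty: "\<psi> y = ereal ty"
        and gx: "gx - g k - blinfun_apply (G' (u k)) (x - u k) \<le> L / p * norm (x - u k) powr p"
      for k x y sx ty gx
    proof -
      let ?a = "norm (x - u k)" and ?b = "norm (y - v k)"
      have "ereal (\<mu>1 / p * ?a powr p) \<le> bregman \<phi> x (u k)"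
        using assms(32) sx s[of k] by (simp add: strongly_convex_fun_def edom_def)
      then have "\<mu>1 / p * ?a powr p \<le> sx - s k - blinfun_apply (\<eta> k) (x - u k)"
        by (simp add: bregman_eq[OF \<eta>] sx s)
      then have 1: "1 / \<tau> * (\<mu>1 / p * ?a powr p) \<le> 1 / \<tau> * (sx - s k - blinfun_apply (\<eta> k) (x - u k))"
        using stepsize(1) by (intro mult_left_mono) auto
      have "ereal (\<mu>2 / q * ?b powr q) \<le> bregman \<psi> y (v k)"
        using assms(41) ty t[of k] by (simp add: strongly_convex_fun_def edom_def)
      then have "\<mu>2 / q * ?b powr q \<le> ty - t k - blinfun_apply (\<theta> k) (y - v k)"
        by (simp add: bregman_eq[OF \<theta>] ty t)
      then have 2: "1 / \<sigma> * (\<mu>2 / q * ?b powr q) \<le> 1 / \<sigma> * (ty - t k - blinfun_apply (\<theta> k) (y - v k))"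
        using stepsize(2) by (intro mult_left_mono) auto
      have "blinfun_apply (y - v k) (blinfun_apply K (x - u k)) \<le> ?b * norm (blinfun_apply K (x - u k))"
        using norm_blinfun[of "y - v k" "blinfun_apply K (x - u k)"] by simp
      also have "\<dots> \<le> ?b * (norm K * ?a)"
        by (intro mult_left_mono norm_blinfun) simp
      finally have 3: "blinfun_apply (y - v k) (blinfun_apply K (x - u k)) \<le> norm K * ?a * ?b"
        by (simp add: mult_ac)
      show ?thesis
        using coupling[of ?a ?b] 1 2 3 gx by (simp add: mult.commute)
    qed
    have ubar_int: "ubar \<in> interior (edom G)"
      using assms(17) by (intro interior_of_finite_sum[OF assms(18)] R) (auto simp: edom_def)
    have smooth_dag: "gs - g k - blinfun_apply (G' (u k)) (udag - u k) \<le> L / p * norm (udag - u k) powr p" for k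
    proof (rule smooth_bound_at_subgradient_point[OF R G assms(16) _ ubar_int _ source rs gs u_int \<gamma> g])
      show "p > 0" using pq by simp
      show "R ubar < \<infinity>" using assms(17) by (simp add: edom_def)
    qed
    have lower: "c * norm (vdag - v k) powr q \<le> \<Delta> k" for k
      unfolding \<Delta>_def by (rule B_lower[OF real ts smooth_dag])
    have d_nonneg: "d k \<ge> 0" for k
      using subdiffD[OF source, of "rs + gs" "u k" "r k + g k"] subdiffD[OF assms(49)[folded Hs_def] hs, of "v k" "h k"]
      by (simp add: d_def rs gs r g h)
    have descent: "d (Suc k) \<le> \<Delta> k - \<Delta> (Suc k) + (C * \<delta>) * norm (vdag - v (Suc k))" for k
    proof -
      have "g (Suc k) - g k - blinfun_apply (G' (u k)) (u (Suc k) - u k)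
          \<le> L / p * norm (u (Suc k) - u k) powr p"
        using assms(16) u_int[of k] u_int[of "Suc k"] bregman_eq[OF \<gamma>, of "u (Suc k)" k] g
        unfolding smooth_fun_def by fastforce
      note low = B_lower[OF s t this]
      have "0 \<le> 1 / \<tau> * (s (Suc k) - s k - blinfun_apply (\<eta> k) (u (Suc k) - u k))
        + 1 / \<sigma> * (t (Suc k) - t k - blinfun_apply (\<theta> k) (v (Suc k) - v k))
        - blinfun_apply (v (Suc k) - v k) (blinfun_apply K (u (Suc k) - u k))
        - (g (Suc k) - g k - blinfun_apply (G' (u k)) (u (Suc k) - u k))"
        by (rule order_trans[OF _ low]) (use c in simp)
      moreover have "r (Suc k) + blinfun_apply (- (G' (u k) + (v k o\<^sub>L K) + (1 / \<tau>) *\<^sub>R (\<eta> (Suc k) - \<eta> k)))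
          (udag - u (Suc k)) \<le> rs"
        using subdiffD[OF primal_sub r, of udag rs] by (simp add: rs l_def)
      moreover have "h (Suc k) + blinfun_apply (- (m k + (1 / \<sigma>) *\<^sub>R (\<theta> (Suc k) - \<theta> k)))
          (vdag - v (Suc k)) \<le> hs"
        using subdiffD[OF dual_sub h, of vdag hs] by (simp add: hs)
      moreover have "g (Suc k) + blinfun_apply (G' (u (Suc k))) (udag - u (Suc k)) \<le> gs"
        using subdiffD[OF \<gamma>_sub g, of udag gs] by (simp add: gs)
      ultimately have "d (Suc k) \<le> \<Delta> k - \<Delta> (Suc k)
          + (blinfun_apply \<zeta>\<delta> (vdag - v (Suc k)) - blinfun_apply (vdag - v (Suc k)) (blinfun_apply K udag))"
        unfolding d_def \<Delta>_def by (intro primal_dual_descent[OF _ _ m])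
      \<comment> \<open>\<open>\<zeta>\<close> is evaluation at \<open>f = K udag\<close>, so the
        left-hand side is the pairing of \<open>\<zeta>\<delta> - \<zeta>\<close> with
        \<open>vdag - v (Suc k)\<close>.\<close>
      moreover have "blinfun_apply \<zeta>\<delta> (vdag - v (Suc k)) - blinfun_apply (vdag - v (Suc k)) (blinfun_apply K udag)
          \<le> C * \<delta> * norm (vdag - v (Suc k))"
        using assms(51)[of "Suc k"] subdiff_conj_fun_singleton[OF assms(50)]
        by (simp add: blinfun.diff_left solution(1))
      ultimately show ?thesis by simp
    qed

    \<comment> \<open>Summation, averaging and the constants\<close>
    have breg: "bregman ?B ?W (u 0, v 0) = ereal (\<Delta> 0)"
    proof -
      have "?B ?W = ereal (1 / \<tau> * ss + 1 / \<sigma> * ts - blinfun_apply vdag (blinfun_apply K udag) - gs)"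
        by (simp add: B_fun_def real ts gs)
      then show ?thesis
        by (simp add: bregman_eq[OF \<Xi>] B0 \<Xi>_apply \<Delta>_def blinfun.diff_left blinfun.diff_right algebra_simps)
    qed
    have E: "C * \<delta> \<ge> 0" using assms(48) \<delta> by simp
    have sum: "(\<Sum>k=1..n. d k) \<le> \<Delta> 0 + C * \<delta> * real n
        * ((p * \<Delta> 0 / c) powr (1 / q) + (C * \<delta> * real n / c) powr (p / q))"
      by (rule telescoping_error_bound[where b = "\<lambda>k. norm (vdag - v k)", OF pq c E norm_ge_zero d_nonneg lower descent])
    obtain n' where n': "n = Suc n'" using n by (cases n) auto
    have avg_R: "R (avg u n) \<le> ereal (avg r n)" and avg_G: "G (avg u n) \<le> ereal (avg g n)"
      and avg_H: "Hs (avg v n) \<le> ereal (avg h n)"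
      unfolding n' by (rule econvex_avg; simp add: R G Hs r g h)+
    \<comment> \<open>All terms other than the function values are affine and commute with the mean;
      Jensen's inequality then handles the function values.\<close>
    have avg_d: "avg d n = (avg r n + avg g n - (rs + gs) - blinfun_apply (- (vdag o\<^sub>L K)) (avg u n - udag))
        + (avg h n - hs - blinfun_apply \<zeta>\<delta> (avg v n - vdag))"
      using n unfolding avg_def d_def
      by (simp add: sum.distrib sum_subtractf blinfun.sum_right blinfun.minus_left blinfun.diff_right
          blinfun.scaleR_right sum_negf field_simps)
    have "D (avg u n) (avg v n) \<le> ereal (avg d n)"
      using avg_R avg_G avg_H R(2)[of "avg u n"] G(2)[of "avg u n"] Hs(2)[of "avg v n"]
      by (cases "R (avg u n)"; cases "G (avg u n)"; cases "Hs (avg v n)")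
        (auto simp: D_def bregman_wrt_def rs gs hs avg_d)
    \<comment> \<open>With \<open>\<nu> = q * c\<close> the factor
      \<open>q powr (p / q) / \<nu> powr (p / q)\<close> is \<open>1 / c powr (p - 1)\<close>, and
      \<open>p * q / \<nu>\<close> is \<open>p / c\<close>.\<close>
    also have "avg d n \<le> 1 / real n * \<Delta> 0 + C powr p * q powr (p / q) / (q * c) powr (p / q) * \<delta> powr p * real n powr (p - 1)
      + C * (p * q / (q * c) * \<Delta> 0) powr (1 / q) * \<delta>"
    proof -
      have pq1: "p / q = p - 1"
        using conjugate_exponent_quotient[OF pq] .
      have "C * \<delta> * (C * \<delta> * real n / c) powr (p - 1)
          = (C * \<delta> * (C * \<delta>) powr (p - 1)) * real n powr (p - 1) / c powr (p - 1)"
        using E c by (simp add: powr_mult powr_divide)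
      also have "C * \<delta> * (C * \<delta>) powr (p - 1) = C powr p * \<delta> powr p"
        using powr_mult_base[OF E, of "p - 1"] assms(48) \<delta> by (simp add: powr_mult)
      finally have err: "C * \<delta> * (C * \<delta> * real n / c) powr (p / q)
          = C powr p * q powr (p / q) / (q * c) powr (p / q) * \<delta> powr p * real n powr (p - 1)"
        using pq c by (simp add: pq1 powr_mult)
      have "avg d n = (\<Sum>k=1..n. d k) / real n"
        by (simp add: avg_def)
      also have "\<dots> \<le> (\<Delta> 0 + C * \<delta> * real n
          * ((p * \<Delta> 0 / c) powr (1 / q) + (C * \<delta> * real n / c) powr (p / q))) / real n"
        using sum by (intro divide_right_mono) auto
      also have "\<dots> = 1 / real n * \<Delta> 0 + C * \<delta> * (C * \<delta> * real n / c) powr (p / q)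
          + C * (p * \<Delta> 0 / c) powr (1 / q) * \<delta>"
        using n by (simp add: field_simps)
      finally show ?thesis
        unfolding err using pq by simp
    qed
    finally show ?thesis
      by (simp add: breg epowr_def)
  qed
  show ?thesis
  proof (rule exI[of _ "q * c"], intro conjI exI[of _ C] allI impI)
    show "0 < q * c" using pq c by simp
    show "0 < C" by (rule assms(48))
  qed (use main in \<open>simp only: D_def Hs_def\<close>)
qed

end
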